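(* Let $A$ be a unital C*-algebra and $\{x_j : j\in\mathbb J\}$ a standard frame in a finitely or countably generated Hilbert $A$-module $\mathcal H$. Then there exists a unique operator $S\in\mathrm{End}_A^*(\mathcal H)$ such that $$x=\sum_j\langle x,S(x_j)\rangle x_j\quad\text{for every }x\in\mathcal H.$$ Explicitly, $S=G^*G$ for any adjointable invertible bounded $A$-linear operator $G$ from $\mathcal H$ onto some Hilbert $A$-module $\mathcal K$ such that $\{G(x_j): j\in\mathbb J\}$ is a standard normalized tight frame in $\mathcal K$. In particular $S=\theta^{-1}(\theta^* )^{-1}=(\theta^*\theta)^{-1}$, where $\theta$ is the frame transform regarded as an operator from $\mathcal H$ onto its range $\theta(\mathcal H)$; hence $S$ is positive and invertible. Finally, the canonical dual frame $\{S(x_j) : j\in\mathbb J\}$ is again a standard frame for $\mathcal H$.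
   Context: A (left) Hilbert $A$-module is a left $A$-module $\mathcal H$ with an $A$-valued inner product $\langle\cdot,\cdot\rangle$, $A$-linear in the first argument, with $\langle x,y\rangle=\langle y,x\rangle^*$, $\langle x,x\rangle\ge0$ and $=0$ only for $x=0$, complete in $\|x\|=\|\langle x,x\rangle\|^{1/2}$. Finitely generated: every element is an $A$-linear combination of finitely many fixed elements; countably generated: some countable subset has norm-dense $A$-linear span. $\mathrm{End}_A^*(\mathcal H)$ is the C*-algebra of adjointable bounded $A$-linear operators on $\mathcal H$. $l_2(A)$ is the module of sequences $(a_j)$ with $\sum_ja_ja_j^*$ norm-convergent, inner product $\sum_ja_jb_j^*$. A sequence $\{x_j:j\in\mathbb J\}$ ($\mathbb J$ finite or countable) is a frame if there are $C,D>0$ with $C\langle x,x\rangle\le\sum_j\langle x,x_j\rangle\langle x_j,x\rangle\le D\langle x,x\rangle$ for all $x$; normalized tight if $C=D=1$ works; standard if this series converges in norm for all $x$. The frame transform is $\theta:\mathcal H\to l_2(A)$, $\theta(x)=\{\langle x,x_j\rangle\}_j$; it is adjointable with closed range. The canonical dual frame of $\{x_j\}$ is $\{(\theta^*\theta)^{-1}(x_j)\}$. *)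

theory Defs
  imports Complex_Main "HOL-Library.Countable_Set"
begin

class cstar_algebra = real_normed_algebra_1 + banach +
  fixes scaleC :: "complex \<Rightarrow> 'a \<Rightarrow> 'a"
    and cstar :: "'a \<Rightarrow> 'a"
  assumes scaleC_add_right: "scaleC c (x + y) = scaleC c x + scaleC c y"
    and scaleC_add_left: "scaleC (c + d) x = scaleC c x + scaleC d x"
    and scaleC_scaleC: "scaleC c (scaleC d x) = scaleC (c * d) x"
    and scaleC_one: "scaleC 1 x = x"
    and scaleC_of_real: "scaleC (complex_of_real r) x = scaleR r x"
    and scaleC_mult_left: "scaleC c x * y = scaleC c (x * y)"
    and scaleC_mult_right: "x * scaleC c y = scaleC c (x * y)"
    and norm_scaleC: "norm (scaleC c x) = cmod c * norm x"
    and cstar_add: "cstar (x + y) = cstar x + cstar y"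
    and cstar_scaleC: "cstar (scaleC c x) = scaleC (cnj c) (cstar x)"
    and cstar_mult: "cstar (x * y) = cstar y * cstar x"
    and cstar_cstar: "cstar (cstar x) = x"
    and cstar_identity: "norm (cstar x * x) = (norm x)\<^sup>2"

definition cstar_pos :: "'a::cstar_algebra \<Rightarrow> bool" where
  "cstar_pos a \<longleftrightarrow> (\<exists>b. a = cstar b * b)"

definition cstar_le :: "'a::cstar_algebra \<Rightarrow> 'a \<Rightarrow> bool" where
  "cstar_le a b \<longleftrightarrow> cstar_pos (b - a)"

definition hnorm :: "('h \<Rightarrow> 'h \<Rightarrow> 'a::cstar_algebra) \<Rightarrow> 'h \<Rightarrow> real" where
  "hnorm ip x = sqrt (norm (ip x x))"

definition hcomplete :: "('h::ab_group_add \<Rightarrow> 'h \<Rightarrow> 'a::cstar_algebra) \<Rightarrow> bool" where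
  "hcomplete ip \<longleftrightarrow>
     (\<forall>f :: nat \<Rightarrow> 'h.
        (\<forall>e>0. \<exists>N. \<forall>m\<ge>N. \<forall>n\<ge>N. hnorm ip (f m - f n) < e) \<longrightarrow>
        (\<exists>l. (\<lambda>n. hnorm ip (f n - l)) \<longlonglongrightarrow> 0))"

definition hilbert_module ::
  "('a::cstar_algebra \<Rightarrow> 'h::ab_group_add \<Rightarrow> 'h) \<Rightarrow> ('h \<Rightarrow> 'h \<Rightarrow> 'a) \<Rightarrow> bool" where
  "hilbert_module act ip \<longleftrightarrow>
     (\<forall>a x y. act a (x + y) = act a x + act a y) \<and>
     (\<forall>a b x. act (a + b) x = act a x + act b x) \<and>
     (\<forall>a b x. act (a * b) x = act a (act b x)) \<and>
     (\<forall>x. act 1 x = x) \<and>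
     (\<forall>x y z. ip (x + y) z = ip x z + ip y z) \<and>
     (\<forall>a x y. ip (act a x) y = a * ip x y) \<and>
     (\<forall>x y. ip x y = cstar (ip y x)) \<and>
     (\<forall>x. cstar_pos (ip x x)) \<and>
     (\<forall>x. ip x x = 0 \<longrightarrow> x = 0) \<and>
     hcomplete ip"

definition alin_span :: "('a::cstar_algebra \<Rightarrow> 'h::ab_group_add \<Rightarrow> 'h) \<Rightarrow> 'h set \<Rightarrow> 'h set" where
  "alin_span act Gs = {y. \<exists>F c. finite F \<and> F \<subseteq> Gs \<and> y = (\<Sum>g\<in>F. act (c g) g)}"

definition countably_generated ::
  "('a::cstar_algebra \<Rightarrow> 'h::ab_group_add \<Rightarrow> 'h) \<Rightarrow> ('h \<Rightarrow> 'h \<Rightarrow> 'a) \<Rightarrow> bool" where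
  "countably_generated act ip \<longleftrightarrow>
     (\<exists>Gs. countable Gs \<and> (\<forall>x. \<forall>e>0. \<exists>y\<in>alin_span act Gs. hnorm ip (x - y) < e))"

definition hsums :: "('h::ab_group_add \<Rightarrow> 'h \<Rightarrow> 'a::cstar_algebra) \<Rightarrow> (nat \<Rightarrow> 'h) \<Rightarrow> nat set \<Rightarrow> 'h \<Rightarrow> bool" where
  "hsums ip f J s \<longleftrightarrow> (\<lambda>n. hnorm ip ((\<Sum>j\<in>J \<inter> {..<n}. f j) - s)) \<longlonglongrightarrow> 0"

definition frame_terms :: "('h \<Rightarrow> 'h \<Rightarrow> 'a::cstar_algebra) \<Rightarrow> nat set \<Rightarrow> (nat \<Rightarrow> 'h) \<Rightarrow> 'h \<Rightarrow> nat \<Rightarrow> 'a" where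
  "frame_terms ip J xs x = (\<lambda>j. if j \<in> J then ip x (xs j) * ip (xs j) x else 0)"

definition standard_frame :: "('h \<Rightarrow> 'h \<Rightarrow> 'a::cstar_algebra) \<Rightarrow> nat set \<Rightarrow> (nat \<Rightarrow> 'h) \<Rightarrow> bool" where
  "standard_frame ip J xs \<longleftrightarrow>
     (\<exists>C D. C > 0 \<and> D > 0 \<and>
        (\<forall>x. \<exists>s. frame_terms ip J xs x sums s \<and>
               cstar_le (C *\<^sub>R ip x x) s \<and> cstar_le s (D *\<^sub>R ip x x)))"

definition standard_nt_frame :: "('h \<Rightarrow> 'h \<Rightarrow> 'a::cstar_algebra) \<Rightarrow> nat set \<Rightarrow> (nat \<Rightarrow> 'h) \<Rightarrow> bool" where
  "standard_nt_frame ip J xs \<longleftrightarrow>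
     (\<forall>x. \<exists>s. frame_terms ip J xs x sums s \<and>
            cstar_le (ip x x) s \<and> cstar_le s (ip x x))"

definition is_adjoint :: "('h \<Rightarrow> 'h \<Rightarrow> 'a) \<Rightarrow> ('k \<Rightarrow> 'k \<Rightarrow> 'a) \<Rightarrow> ('h \<Rightarrow> 'k) \<Rightarrow> ('k \<Rightarrow> 'h) \<Rightarrow> bool" where
  "is_adjoint ipH ipK T Ts \<longleftrightarrow> (\<forall>x y. ipK (T x) y = ipH x (Ts y))"

definition adjointable :: "('h \<Rightarrow> 'h \<Rightarrow> 'a) \<Rightarrow> ('k \<Rightarrow> 'k \<Rightarrow> 'a) \<Rightarrow> ('h \<Rightarrow> 'k) \<Rightarrow> bool" where
  "adjointable ipH ipK T \<longleftrightarrow> (\<exists>Ts. is_adjoint ipH ipK T Ts)"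

definition alinear :: "('a \<Rightarrow> 'h::plus \<Rightarrow> 'h) \<Rightarrow> ('a \<Rightarrow> 'k::plus \<Rightarrow> 'k) \<Rightarrow> ('h \<Rightarrow> 'k) \<Rightarrow> bool" where
  "alinear actH actK T \<longleftrightarrow> (\<forall>x y. T (x + y) = T x + T y) \<and> (\<forall>a x. T (actH a x) = actK a (T x))"

definition bounded_op :: "('h \<Rightarrow> 'h \<Rightarrow> 'a::cstar_algebra) \<Rightarrow> ('k \<Rightarrow> 'k \<Rightarrow> 'a) \<Rightarrow> ('h \<Rightarrow> 'k) \<Rightarrow> bool" where
  "bounded_op ipH ipK T \<longleftrightarrow> (\<exists>M. \<forall>x. hnorm ipK (T x) \<le> M * hnorm ipH x)"

text \<open>Elements of \<open>l\<^sub>2(A)\<close> are sequences indexed by \<open>\<nat>\<close>; \<open>l\<^sub>2(A)\<close> over \<open>J\<close> is identified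
  with the sequences vanishing off \<open>J\<close>.\<close>

definition l2 :: "(nat \<Rightarrow> 'a::cstar_algebra) set" where
  "l2 = {a. summable (\<lambda>j. a j * cstar (a j))}"

definition l2ip :: "(nat \<Rightarrow> 'a::cstar_algebra) \<Rightarrow> (nat \<Rightarrow> 'a) \<Rightarrow> 'a" where
  "l2ip a b = (\<Sum>j. a j * cstar (b j))"

definition frame_transform :: "('h \<Rightarrow> 'h \<Rightarrow> 'a::cstar_algebra) \<Rightarrow> nat set \<Rightarrow> (nat \<Rightarrow> 'h) \<Rightarrow> 'h \<Rightarrow> nat \<Rightarrow> 'a" where
  "frame_transform ip J xs x = (\<lambda>j. if j \<in> J then ip x (xs j) else 0)"

end

theory Submission
  imports Defs "HOL-Analysis.Analysis"
begin

text \<open>Positivity in a C*-algebra is reduced to the order-unit condition \<open>norm (t - a) \<le> t\<close>, which is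
  visibly a closed convex cone; square roots come from the binomial series of \<open>sqrt (1 - x)\<close>, and no
  spectral theory is used. The frame operator \<open>F x = \<Sum> \<langle>x, x\<^sub>j\<rangle> x\<^sub>j\<close> is self-adjoint with
  \<open>C \<langle>x, x\<rangle> \<le> \<langle>F x, x\<rangle> \<le> D \<langle>x, x\<rangle>\<close> and \<open>C F \<le> F\<^sup>2 \<le> D F\<close>. Hence \<open>K = 1 - F / D\<close> is a strict contraction,
  and \<open>S = F\<^bsup>-1\<^esup>\<close> is the square of a self-adjoint multiple of the power series \<open>(1 - K)\<^bsup>-1/2\<^esup>\<close>. The
  reconstruction formula for an operator \<open>S'\<close> says exactly \<open>F S'\<^sup>* = 1\<close>, which gives uniqueness. If
  \<open>G x\<^sub>j\<close> is a normalized tight frame, then \<open>G F G\<^sup>* = 1\<close> by polarization, so \<open>G\<^sup>*G = F\<^bsup>-1\<^esup>\<close>.\<close>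

section \<open>Positive elements of a C*-algebra\<close>

lemma cstar_0 [simp]: "cstar (0::'a::cstar_algebra) = 0"
  using cstar_add[of "0::'a" 0] by simp

lemma cstar_minus [simp]: "cstar (- x) = - cstar (x::'a::cstar_algebra)"
  using cstar_add[of x "-x"] by (simp add: eq_neg_iff_add_eq_0 add.commute)

lemma cstar_diff: "cstar (x - y) = cstar x - cstar (y::'a::cstar_algebra)"
  using cstar_add[of x "-y"] by simp

lemma cstar_scaleR [simp]: "cstar (r *\<^sub>R x) = r *\<^sub>R cstar (x::'a::cstar_algebra)"
  by (metis complex_cnj_complex_of_real cstar_scaleC scaleC_of_real)

lemma scaleC_minus_right: "scaleC c (- x) = - scaleC c (x::'a::cstar_algebra)"
  using scaleC_mult_right[of x c "-1"] scaleC_mult_right[of x c 1]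
    scaleC_mult_left[of c x "-1"] by simp

lemma scaleC_minus_left: "scaleC (- c) x = - scaleC c (x::'a::cstar_algebra)"
proof -
  have "scaleC (- c) x = scaleC c (scaleC (complex_of_real (- 1)) x)"
    by (simp add: scaleC_scaleC)
  then show ?thesis by (simp add: scaleC_of_real scaleC_minus_right del: of_real_minus)
qed

lemma scaleC_diff_right: "scaleC c (x - y) = scaleC c x - scaleC c (y::'a::cstar_algebra)"
  using scaleC_add_right[of c x "- y"] by (simp add: scaleC_minus_right)

lemma scaleC_i_i: "scaleC \<i> (scaleC \<i> x) = - (x::'a::cstar_algebra)"
  using scaleC_of_real[of "-1" x] by (simp add: scaleC_scaleC)

lemma cstar_1 [simp]: "cstar (1::'a::cstar_algebra) = 1"
  by (metis cstar_cstar cstar_mult mult.right_neutral)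

lemma norm_cstar [simp]: "norm (cstar x) = norm (x::'a::cstar_algebra)"
proof -
  have *: "norm y \<le> norm (cstar y)" for y :: 'a
  proof (cases "y = 0")
    case False
    have "norm y * norm y \<le> norm (cstar y) * norm y"
      using norm_mult_ineq[of "cstar y" y] by (simp add: cstar_identity power2_eq_square)
    then show ?thesis using False by simp
  qed simp
  show ?thesis using *[of x] *[of "cstar x"] by (simp add: cstar_cstar)
qed

lemma bounded_linear_cstar: "bounded_linear (cstar :: 'a::cstar_algebra \<Rightarrow> 'a)"
  by (rule bounded_linear_intro[where K = 1]) (simp_all add: cstar_add)

lemma cstar_sum: "cstar (sum f I) = (\<Sum>i\<in>I. cstar (f i :: 'a::cstar_algebra))"
  using bounded_linear.linear[OF bounded_linear_cstar] by (rule linear_sum)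

lemma norm_selfadjoint_square:
  fixes h :: "'a::cstar_algebra"
  assumes "cstar h = h"
  shows "norm (h * h) = (norm h)\<^sup>2"
  using cstar_identity[of h] assms by simp

lemma selfadjoint_square_eq_0:
  fixes h :: "'a::cstar_algebra"
  assumes "cstar h = h" "h * h = 0"
  shows "h = 0"
  using norm_selfadjoint_square[OF assms(1)] assms(2) by simp

section \<open>Coefficients of the binomial series of \<open>sqrt (1 - x)\<close> and
  \<open>1 / sqrt (1 - x)\<close>\<close>

definition sqrt_coeff :: "nat \<Rightarrow> real" where
  "sqrt_coeff n = (- 1) ^ n * ((1 / 2) gchoose n)"

definition isqrt_coeff :: "nat \<Rightarrow> real" where
  "isqrt_coeff n = (- 1) ^ n * ((- 1 / 2) gchoose n)"

lemma isqrt_coeff_Suc: "isqrt_coeff (Suc n) = isqrt_coeff n * ((2 * real n + 1) / (2 * real n + 2))"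
proof -
  have "(- 1 / 2 :: real) gchoose Suc n = ((- 1 / 2) gchoose n) * ((- 1 / 2 - real n) / (real n + 1))"
    by (simp add: gbinomial_absorption' gbinomial_prod_rev prod.atLeast0_lessThan_Suc field_simps)
  then show ?thesis
    unfolding isqrt_coeff_def by (simp only:) (simp add: field_simps)
qed

lemma isqrt_coeff_bounds: "0 \<le> isqrt_coeff n \<and> isqrt_coeff n \<le> 1"
proof (induction n)
  case 0
  show ?case by (simp add: isqrt_coeff_def)
next
  case (Suc n)
  have "0 \<le> (2 * real n + 1) / (2 * real n + 2)" "(2 * real n + 1) / (2 * real n + 2) \<le> 1"
    by simp_all
  with Suc show ?case
    unfolding isqrt_coeff_Suc by (intro conjI mult_nonneg_nonneg mult_le_one) auto
qed

text \<open>Multiplying a power series by \<open>1 / (1 - x)\<close> replaces its coefficients by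
  their partial sums, and \<open>sqrt (1 - x) / (1 - x) = 1 / sqrt (1 - x)\<close>.\<close>

lemma sum_sqrt_coeff: "(\<Sum>n\<le>N. sqrt_coeff n) = isqrt_coeff N"
  using gbinomial_sum_lower_neg[of "1/2::real" N]
  unfolding sqrt_coeff_def isqrt_coeff_def by (simp add: mult.commute)

lemma sqrt_coeff_0 [simp]: "sqrt_coeff 0 = 1"
  by (simp add: sqrt_coeff_def)

lemma sqrt_coeff_Suc_nonpos: "sqrt_coeff (Suc n) \<le> 0"
proof -
  have "sqrt_coeff (Suc n) = isqrt_coeff (Suc n) - isqrt_coeff n"
    using sum_sqrt_coeff[of "Suc n"] sum_sqrt_coeff[of n] by simp
  also have "\<dots> = isqrt_coeff n * ((2 * real n + 1) / (2 * real n + 2) - 1)"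
    by (simp add: isqrt_coeff_Suc algebra_simps)
  also have "\<dots> \<le> 0"
    using isqrt_coeff_bounds[of n] by (intro mult_nonneg_nonpos) auto
  finally show ?thesis .
qed

text \<open>After the leading 1 no coefficient is positive, so the absolute values telescope to
  \<open>1 - isqrt_coeff N\<close>.\<close>

lemma sum_abs_sqrt_coeff: "(\<Sum>n<N. \<bar>sqrt_coeff (Suc n)\<bar>) \<le> 1"
proof -
  have "(\<Sum>n<N. \<bar>sqrt_coeff (Suc n)\<bar>) = - (\<Sum>n<N. sqrt_coeff (Suc n))"
    by (simp add: abs_of_nonpos[OF sqrt_coeff_Suc_nonpos] sum_negf)
  also have "\<dots> = 1 - (\<Sum>n\<le>N. sqrt_coeff n)"
    using sum.lessThan_Suc_shift[of sqrt_coeff N] by (simp add: lessThan_Suc_atMost del: sum.lessThan_Suc)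
  also have "\<dots> \<le> 1"
    using isqrt_coeff_bounds[of N] by (simp add: sum_sqrt_coeff)
  finally show ?thesis .
qed

lemma summable_abs_sqrt_coeff_Suc: "summable (\<lambda>n. \<bar>sqrt_coeff (Suc n)\<bar>)"
  by (rule summableI_nonneg_bounded[OF _ sum_abs_sqrt_coeff]) simp

lemma summable_abs_sqrt_coeff: "summable (\<lambda>n. \<bar>sqrt_coeff n\<bar>)"
  using summable_abs_sqrt_coeff_Suc summable_Suc_iff[of "\<lambda>n. \<bar>sqrt_coeff n\<bar>"] by simp

text \<open>Vandermonde's identity: the square of \<open>(1 - x)^a\<close> is
  \<open>(1 - x)^(2 a)\<close>. Only the exponents \<open>1/2\<close> and \<open>-1/2\<close> are
  used.\<close>

lemma convolution_gbinomial_sign: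
  fixes a :: real
  shows "(\<Sum>k\<le>n. ((- 1) ^ k * (a gchoose k)) * ((- 1) ^ (n - k) * (a gchoose (n - k))))
    = (- 1) ^ n * ((2 * a) gchoose n)"
proof -
  have "(\<Sum>k\<le>n. ((- 1) ^ k * (a gchoose k)) * ((- 1) ^ (n - k) * (a gchoose (n - k))))
     = (\<Sum>k\<le>n. (- 1) ^ n * ((a gchoose k) * (a gchoose (n - k))))"
  proof (rule sum.cong[OF refl])
    fix k assume "k \<in> {..n}"
    then have "(- 1 :: real) ^ n = (- 1) ^ k * (- 1) ^ (n - k)"
      by (simp flip: power_add)
    then show "((- 1) ^ k * (a gchoose k)) * ((- 1) ^ (n - k) * (a gchoose (n - k)))
      = (- 1) ^ n * ((a gchoose k) * (a gchoose (n - k)))" by simp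
  qed
  also have "\<dots> = (- 1) ^ n * ((a + a) gchoose n)"
    by (simp add: gbinomial_Vandermonde atMost_atLeast0 flip: sum_distrib_left)
  finally show ?thesis by simp
qed

lemma convolution_isqrt_coeff: "(\<Sum>k\<le>n. isqrt_coeff k * isqrt_coeff (n - k)) = 1"
  using convolution_gbinomial_sign[where a = "-1/2" and n = n] gbinomial_minus[of "1::real" n]
  by (simp add: isqrt_coeff_def flip: power_add binomial_gbinomial)

lemma convolution_sqrt_coeff:
  "(\<Sum>k\<le>n. sqrt_coeff k * sqrt_coeff (n - k)) = (if n = 0 then 1 else if n = 1 then -1 else 0)"
proof -
  have "(1::real) gchoose n = real (1 choose n)"
    by (simp add: binomial_gbinomial)
  then show ?thesis
    using convolution_gbinomial_sign[where a = "1/2" and n = n] by (auto simp add: sqrt_coeff_def)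
qed

text \<open>The binomial series of \<open>sqrt (1 - x)\<close> converges absolutely even for \<open>norm x = 1\<close>.\<close>

lemma sqrt_one_minus:
  fixes x :: "'a::cstar_algebra"
  assumes x: "norm x \<le> 1" and sa: "cstar x = x"
  obtains k where "cstar k = k" "k * k = 1 - x" "norm (1 - k) \<le> 1"
    "\<And>y. x * y = y * x \<Longrightarrow> k * y = y * k"
proof -
  define f where "f n = sqrt_coeff n *\<^sub>R x ^ n" for n
  have xn: "norm (x ^ n) \<le> 1" for n
    using norm_power_ineq[of x n] x by (meson norm_ge_zero order_trans power_le_one)
  have nf: "norm (f n) \<le> \<bar>sqrt_coeff n\<bar>" for n
    using xn[of n] by (simp add: f_def mult_left_le)
  have sn: "summable (\<lambda>n. norm (f n))"
    by (rule summable_comparison_test'[OF summable_abs_sqrt_coeff, of 0]) (simp add: nf)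
  have sf: "summable f" using sn by (rule summable_norm_cancel)
  define k where "k = suminf f"
  have cx: "cstar (x ^ n) = x ^ n" for n
    by (induction n) (simp_all add: cstar_mult sa power_commutes)
  have 1: "cstar k = k"
    unfolding k_def bounded_linear.suminf[OF bounded_linear_cstar sf] by (rule suminf_cong) (simp add: f_def cx)
  have conv: "(\<Sum>i\<le>n. f i * f (n - i)) = (\<Sum>i\<le>n. sqrt_coeff i * sqrt_coeff (n - i)) *\<^sub>R x ^ n" for n
    unfolding scaleR_sum_left f_def
    by (rule sum.cong) (simp_all flip: power_add)
  have "k * k = (\<Sum>n. \<Sum>i\<le>n. f i * f (n - i))"
    unfolding k_def by (rule Cauchy_product[OF sn sn])
  also have "\<dots> = (\<Sum>n. (if n = 0 then 1 else if n = 1 then -1 else 0) *\<^sub>R x ^ n)"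
    by (simp only: conv convolution_sqrt_coeff)
  also have "\<dots> = (\<Sum>n\<in>{0,1}. (if n = 0 then 1 else if n = 1 then -1 else 0) *\<^sub>R x ^ n)"
    by (rule suminf_finite) auto
  also have "\<dots> = 1 - x" by simp
  finally have 2: "k * k = 1 - x" .
  \<comment> \<open>The constant term is 1, so \<open>1 - k\<close> is the negated tail of the
    series.\<close>
  have "k = f 0 + (\<Sum>n. f (Suc n))"
    unfolding k_def using suminf_split_head[OF sf] by simp
  then have "norm (1 - k) = norm (\<Sum>n. f (Suc n))"
    by (simp add: f_def)
  also have "\<dots> \<le> (\<Sum>n. \<bar>sqrt_coeff (Suc n)\<bar>)"
    by (rule norm_suminf_le[OF nf summable_abs_sqrt_coeff_Suc])
  also have "\<dots> \<le> 1"
    by (rule suminf_le_const[OF summable_abs_sqrt_coeff_Suc sum_abs_sqrt_coeff])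
  finally have 3: "norm (1 - k) \<le> 1" .
  have 4: "k * y = y * k" if "x * y = y * x" for y
  proof -
    have "x ^ n * y = y * x ^ n" for n
      using that by (rule power_commuting_commutes)
    then have "f n * y = y * f n" for n by (simp add: f_def)
    then show ?thesis
      unfolding k_def using suminf_mult[OF sf, of y] suminf_mult2[OF sf, of y] by simp
  qed
  show ?thesis using that 1 2 3 4 by blast
qed

text \<open>For commuting self-adjoint \<open>h\<close> and \<open>k\<close>, the element \<open>u = h + ik\<close> satisfies \<open>u\<^sup>*u = h\<^sup>2 + k\<^sup>2\<close>.\<close>

lemma norm_square_le_sum_squares:
  fixes h k :: "'a::cstar_algebra"
  assumes h: "cstar h = h" and k: "cstar k = k" and hk: "h * k = k * h"
  shows "(norm h)\<^sup>2 \<le> norm (h * h + k * k)"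
proof -
  define u where "u = h + scaleC \<i> k"
  have cu: "cstar u = h - scaleC \<i> k"
    by (simp add: u_def cstar_add cstar_scaleC h k scaleC_minus_left)
  have "cstar u * u = h * h + k * k"
    unfolding cu by (simp add: u_def algebra_simps scaleC_mult_left scaleC_mult_right hk scaleC_i_i scaleC_add_right scaleC_diff_right)
  then have "norm (h * h + k * k) = (norm u)\<^sup>2"
    by (metis cstar_identity)
  moreover have "norm h \<le> norm u"
  proof -
    have "2 *\<^sub>R h = u + cstar u" by (simp add: cu scaleR_2) (simp add: u_def)
    then have "2 * norm h \<le> norm u + norm (cstar u)"
      by (metis norm_scaleR norm_triangle_ineq abs_numeral)
    then show ?thesis by simp
  qed
  ultimately show ?thesis by (simp add: power_mono)
qed

section \<open>Order-unit positivity and square roots\<close>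

definition unit_pos :: "'a::cstar_algebra \<Rightarrow> bool" where
  "unit_pos a \<longleftrightarrow> cstar a = a \<and> (\<exists>t\<ge>0. norm (t *\<^sub>R 1 - a) \<le> t)"

text \<open>The witness \<open>t\<close> is left existential so that witnesses simply add. In
  spectral terms, \<open>norm (t - a) <= t\<close> puts the spectrum of a self-adjoint
  \<open>a\<close> into \<open>[0, 2 t]\<close>.\<close>

lemma unit_pos_add:
  fixes a b :: "'a::cstar_algebra"
  assumes "unit_pos a" "unit_pos b"
  shows "unit_pos (a + b)"
proof -
  obtain s t where st: "s \<ge> 0" "t \<ge> 0" "norm (s *\<^sub>R 1 - a) \<le> s" "norm (t *\<^sub>R 1 - b) \<le> t"
    using assms unfolding unit_pos_def by blast
  have "norm ((s + t) *\<^sub>R 1 - (a + b)) \<le> s + t"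
    using norm_triangle_ineq[of "s *\<^sub>R 1 - a" "t *\<^sub>R 1 - b"] st by (simp add: algebra_simps)
  then show ?thesis
    using assms st unfolding unit_pos_def by (metis cstar_add add_nonneg_nonneg)
qed

lemma unit_pos_scaleR:
  fixes a :: "'a::cstar_algebra"
  assumes "unit_pos a" "r \<ge> 0"
  shows "unit_pos (r *\<^sub>R a)"
proof -
  obtain t where t: "t \<ge> 0" "norm (t *\<^sub>R 1 - a) \<le> t"
    using assms unfolding unit_pos_def by blast
  have "norm (r *\<^sub>R (t *\<^sub>R 1 - a)) \<le> r * t"
    using t assms by (simp add: mult_left_mono)
  then show ?thesis
    using assms t unfolding unit_pos_def
    by (auto simp: scaleR_right_diff_distrib intro!: exI[of _ "r * t"])
qed

text \<open>Rescaling gives \<open>a = t (1 - x)\<close> with \<open>norm x <= 1\<close>, and the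
  binomial root of \<open>1 - x\<close> applies. The commutation clause lets later proofs multiply
  roots of different elements.\<close>

lemma unit_pos_sqrt:
  fixes a :: "'a::cstar_algebra"
  assumes "unit_pos a"
  obtains r where "cstar r = r" "r * r = a" "unit_pos r" "\<And>y. a * y = y * a \<Longrightarrow> r * y = y * r"
proof -
  obtain t0 where t0: "t0 \<ge> 0" "norm (t0 *\<^sub>R 1 - a) \<le> t0" and sa: "cstar a = a"
    using assms unfolding unit_pos_def by blast
  \<comment> \<open>Adding 1 preserves the norm condition and allows division by
    \<open>t\<close>.\<close>
  define t where "t = t0 + 1"
  have t: "t > 0" "norm (t *\<^sub>R 1 - a) \<le> t"
    using t0 norm_triangle_ineq[of "t0 *\<^sub>R 1 - a" 1] by (simp_all add: t_def algebra_simps)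
  define x where "x = (1 / t) *\<^sub>R (t *\<^sub>R 1 - a)"
  have "norm x \<le> 1" "cstar x = x"
    using t sa by (simp_all add: x_def cstar_diff)
  then obtain k where k: "cstar k = k" "k * k = 1 - x" "norm (1 - k) \<le> 1"
    "\<And>y. x * y = y * x \<Longrightarrow> k * y = y * k"
    using sqrt_one_minus by metis
  have kk: "t *\<^sub>R (k * k) = a" using t by (simp add: k(2) x_def scaleR_right_diff_distrib)
  show ?thesis
  proof (rule that[of "sqrt t *\<^sub>R k"])
    show "cstar (sqrt t *\<^sub>R k) = sqrt t *\<^sub>R k" using k(1) by simp
    show "(sqrt t *\<^sub>R k) * (sqrt t *\<^sub>R k) = a" using kk t by simp
    have "unit_pos k" using k(1,3) unfolding unit_pos_def by (auto intro!: exI[of _ 1])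
    then show "unit_pos (sqrt t *\<^sub>R k)" using t by (intro unit_pos_scaleR) auto
    fix y assume "a * y = y * a"
    then have "x * y = y * x" by (simp add: x_def algebra_simps)
    then show "(sqrt t *\<^sub>R k) * y = y * (sqrt t *\<^sub>R k)" using k(4) by simp
  qed
qed

text \<open>With \<open>x = h * h / t\<close>, \<open>g = h / sqrt t\<close> and \<open>k\<close>
  the root of \<open>1 - x\<close>, the elements \<open>k\<close> and \<open>g\<close> commute and
  \<open>k * k + g * g = 1\<close>. Hence \<open>norm k <= 1\<close>, and
  \<open>norm (1 - x)\<close> is the square of \<open>norm k\<close>.\<close>

lemma norm_unit_minus_square:
  fixes h :: "'a::cstar_algebra"
  assumes h: "cstar h = h" and t: "norm (h * h) \<le> t"
  shows "norm (t *\<^sub>R 1 - h * h) \<le> t"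
proof (cases "t = 0")
  case True
  then show ?thesis using t by simp
next
  case False
  then have t0: "t > 0" using t norm_ge_zero[of "h * h"] by linarith
  define x where "x = (1 / t) *\<^sub>R (h * h)"
  have "norm x \<le> 1" "cstar x = x"
    using t t0 h by (simp_all add: x_def cstar_mult)
  then obtain k where k: "cstar k = k" "k * k = 1 - x"
    "\<And>y. x * y = y * x \<Longrightarrow> k * y = y * k"
    using sqrt_one_minus by metis
  define g where "g = (1 / sqrt t) *\<^sub>R h"
  have g: "cstar g = g" "g * g = x" using h t0 by (simp_all add: g_def x_def)
  have "k * g = g * k" by (rule k(3)) (simp only: mult.assoc flip: g(2))
  then have "(norm k)\<^sup>2 \<le> norm (k * k + g * g)"
    by (intro norm_square_le_sum_squares k(1) g(1))
  also have "\<dots> = 1" by (simp add: k(2) g(2))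
  finally have "norm (1 - x) \<le> 1"
    using norm_selfadjoint_square[OF k(1)] by (simp add: k(2))
  then have "t * norm (1 - x) \<le> t" using t0 by simp
  moreover have "t *\<^sub>R 1 - h * h = t *\<^sub>R (1 - x)"
    using t0 by (simp add: x_def scaleR_right_diff_distrib)
  ultimately show ?thesis using t0 by simp
qed

lemma unit_pos_square:
  fixes h :: "'a::cstar_algebra"
  assumes "cstar h = h"
  shows "unit_pos (h * h)"
  unfolding unit_pos_def
  using norm_unit_minus_square[OF assms order_refl] assms by (auto simp: cstar_mult intro!: exI[of _ "norm (h * h)"])

text \<open>Any bound on the norm serves as witness; limits need this uniform choice.\<close>

lemma unit_pos_norm_le:
  fixes a :: "'a::cstar_algebra"
  assumes "unit_pos a" "norm a \<le> t"
  shows "norm (t *\<^sub>R 1 - a) \<le> t"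
  using assms norm_unit_minus_square by (metis unit_pos_sqrt)

lemma unit_pos_norm_minus:
  fixes a :: "'a::cstar_algebra"
  assumes "cstar a = a" "norm a \<le> t"
  shows "unit_pos (t *\<^sub>R 1 - a)"
  unfolding unit_pos_def using assms order_trans[OF norm_ge_zero assms(2)]
  by (auto simp: cstar_diff intro!: exI[of _ t])

text \<open>Commuting roots \<open>r\<close> of \<open>a\<close> and \<open>k\<close> of
  \<open>t - a\<close> satisfy \<open>r * r + k * k = t\<close>, which bounds
  \<open>norm r\<close>.\<close>

lemma norm_le_of_unit_pos:
  fixes a :: "'a::cstar_algebra"
  assumes a: "unit_pos a" and ta: "unit_pos (t *\<^sub>R 1 - a)" and t: "t \<ge> 0"
  shows "norm a \<le> t"
proof -
  obtain r where r: "cstar r = r" "r * r = a" "\<And>y. a * y = y * a \<Longrightarrow> r * y = y * r"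
    using unit_pos_sqrt[OF a] by metis
  obtain k where k: "cstar k = k" "k * k = t *\<^sub>R 1 - a"
    "\<And>y. (t *\<^sub>R 1 - a) * y = y * (t *\<^sub>R 1 - a) \<Longrightarrow> k * y = y * k"
    using unit_pos_sqrt[OF ta] by metis
  have "a * r = r * a" by (simp only: mult.assoc flip: r(2))
  then have "k * r = r * k" by (intro k(3)) (simp add: algebra_simps)
  then have "(norm r)\<^sup>2 \<le> norm (r * r + k * k)"
    by (intro norm_square_le_sum_squares r(1) k(1)) (rule sym)
  then show ?thesis using norm_selfadjoint_square[OF r(1)] t by (simp add: r(2) k(2))
qed

section \<open>Positivity of \<open>cstar b * b\<close>\<close>

text \<open>The classical argument that \<open>c * d\<close> and \<open>d * c\<close> have the same
  nonzero spectrum, in terms of right inverses.\<close>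

lemma inverse_unit_minus_swap:
  fixes c d :: "'a::real_algebra_1"
  assumes t: "t \<noteq> 0" and z: "(t *\<^sub>R 1 - c * d) * z = 1"
  shows "(t *\<^sub>R 1 - d * c) * ((1 / t) *\<^sub>R (1 + d * z * c)) = 1"
proof -
  have cdz: "c * (d * z) = t *\<^sub>R z - 1" using z by (simp add: algebra_simps)
  have "d * c * (d * z * c) = d * (c * (d * z)) * c" by (simp only: mult.assoc)
  also have "\<dots> = t *\<^sub>R (d * z * c) - d * c" by (simp add: cdz algebra_simps)
  finally have *: "d * c * (d * z * c) = t *\<^sub>R (d * z * c) - d * c" .
  have "(t *\<^sub>R 1 - d * c) * (1 + d * z * c) = t *\<^sub>R 1 + t *\<^sub>R (d * z * c) - d * c - d * c * (d * z * c)"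
    by (simp add: algebra_simps)
  also have "\<dots> = t *\<^sub>R 1" by (simp add: *)
  finally show ?thesis using t by simp
qed

text \<open>Neumann series: \<open>t + p = (s + t) (1 - y)\<close> with
  \<open>norm y <= s / (s + t) < 1\<close>.\<close>

lemma unit_pos_shift_right_inverse:
  fixes p :: "'a::cstar_algebra"
  assumes p: "unit_pos p" and t: "t > 0"
  obtains z where "(t *\<^sub>R 1 + p) * z = 1"
proof -
  obtain s where s: "s \<ge> 0" "norm (s *\<^sub>R 1 - p) \<le> s"
    using p unfolding unit_pos_def by blast
  define y where "y = (1 / (s + t)) *\<^sub>R (s *\<^sub>R 1 - p)"
  have "norm y < 1" using s t by (simp add: y_def)
  then have sy: "summable (\<lambda>n. y ^ n)" by (intro summable_norm_cancel[of "\<lambda>n. y ^ n"] summable_comparison_test'[OF summable_geometric, of "norm y" 0])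
      (simp_all add: norm_power_ineq)
  then have "(\<Sum>n. y ^ n) = 1 + (\<Sum>n. y ^ Suc n)" using suminf_split_head[OF sy] by simp
  also have "(\<Sum>n. y ^ Suc n) = y * (\<Sum>n. y ^ n)" using suminf_mult[OF sy, of y] by simp
  finally have "(1 - y) * (\<Sum>n. y ^ n) = 1" by (simp add: algebra_simps)
  moreover have "t *\<^sub>R 1 + p = (s + t) *\<^sub>R (1 - y)"
    using s t by (simp add: y_def scaleR_right_diff_distrib) (simp add: algebra_simps)
  ultimately have "(t *\<^sub>R 1 + p) * ((1 / (s + t)) *\<^sub>R (\<Sum>n. y ^ n)) = 1"
    using s t by simp
  then show ?thesis by (rule that)
qed

text \<open>That is, the norm of a positive element belongs to its spectrum.\<close>

lemma unit_pos_eq_0_of_right_inverse: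
  fixes w :: "'a::cstar_algebra"
  assumes w: "unit_pos w" and z: "(norm w *\<^sub>R 1 - w) * z = 1"
  shows "w = 0"
proof -
  define q where "q = norm w *\<^sub>R 1 - w"
  have wsa: "cstar w = w" using w by (simp add: unit_pos_def)
  have qz: "q * z = 1" using z by (simp add: q_def)
  have q: "unit_pos q" "cstar q = q"
    unfolding q_def using unit_pos_norm_minus[OF wsa order_refl] by (simp_all add: cstar_diff wsa)
  have zq: "cstar z * q = 1" using arg_cong[OF qz, of cstar] by (simp add: cstar_mult q)
  have zsa: "cstar z = z" by (metis mult.assoc mult.left_neutral mult.right_neutral qz zq)
  have z0: "norm z > 0" using qz by auto
  obtain r where r: "cstar r = r" "r * r = q" "\<And>y. q * y = y * q \<Longrightarrow> r * y = y * r"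
    using unit_pos_sqrt[OF q(1)] by metis
  have rz: "r * z = z * r" using qz zq zsa by (intro r(3)) simp
  have "unit_pos (norm z *\<^sub>R 1 - z)" using zsa by (intro unit_pos_norm_minus) simp_all
  then obtain k where k: "cstar k = k" "k * k = norm z *\<^sub>R 1 - z"
    "\<And>y. (norm z *\<^sub>R 1 - z) * y = y * (norm z *\<^sub>R 1 - z) \<Longrightarrow> k * y = y * k"
    using unit_pos_sqrt by metis
  have kr: "k * r = r * k" using rz by (intro k(3)) (simp add: algebra_simps)
  \<comment> \<open>This square equals \<open>(norm z - z) * q = norm z * q - 1\<close>. Its
    positivity says \<open>q >= 1 / norm z\<close>, that is \<open>w <= norm w - 1 / norm z\<close>,
    which is too small for the norm of \<open>w\<close>.\<close>
  have "(k * r) * (k * r) = (k * k) * (r * r)" by (metis kr mult.assoc)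
  also have "\<dots> = norm z *\<^sub>R q - 1"
    using qz zq zsa by (simp add: k(2) r(2) algebra_simps)
  finally have "unit_pos (norm z *\<^sub>R q - 1)"
    using unit_pos_square[of "k * r"] by (simp add: cstar_mult k(1) r(1) kr)
  then have "unit_pos ((1 / norm z) *\<^sub>R (norm z *\<^sub>R q - 1))" by (rule unit_pos_scaleR) simp
  moreover have "(1 / norm z) *\<^sub>R (norm z *\<^sub>R q - 1) = (norm w - 1 / norm z) *\<^sub>R 1 - w"
    using z0 by (simp add: q_def algebra_simps)
  ultimately have up: "unit_pos ((norm w - 1 / norm z) *\<^sub>R 1 - w)" by simp
  show ?thesis
  proof (rule ccontr)
    assume "w \<noteq> 0"
    \<comment> \<open>Adding \<open>w\<close> leaves a multiple of 1 and shows the scalar to be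
      nonnegative, as \<open>norm_le_of_unit_pos\<close> demands of its bound.\<close>
    have "unit_pos ((norm w - 1 / norm z) *\<^sub>R 1 - w + w)" using up w by (rule unit_pos_add)
    then have "unit_pos ((norm w - 1 / norm z) *\<^sub>R (1::'a))" by simp
    then have "norm w - 1 / norm z \<ge> 0"
    proof -
      define v where "v = norm w - 1 / norm z"
      assume "unit_pos ((norm w - 1 / norm z) *\<^sub>R (1::'a))"
      then obtain s where s: "s \<ge> 0" "norm (s *\<^sub>R 1 - v *\<^sub>R (1::'a)) \<le> s"
        unfolding unit_pos_def v_def by blast
      have "norm (s *\<^sub>R 1 - v *\<^sub>R (1::'a)) = \<bar>s - v\<bar>"
        by (metis norm_scaleR norm_one mult.right_neutral scaleR_left_diff_distrib)
      then have "v \<ge> 0" using s by linarith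
      then show ?thesis by (simp add: v_def)
    qed
    then have "norm w \<le> norm w - 1 / norm z" using w up by (intro norm_le_of_unit_pos)
    then show False using z0 by (simp add: field_simps)
  qed
qed

text \<open>Up to real factors \<open>h\<close> and \<open>k\<close> are the real and imaginary
  parts of \<open>c\<close>, so \<open>c * cstar c + cstar c * c\<close> is positive, and then so is
  \<open>c * cstar c\<close>. For nonzero \<open>c\<close>,
  \<open>norm (c * cstar c) - cstar c * c\<close> has a right inverse; swapping the factors
  contradicts that the norm of \<open>c * cstar c\<close> lies in its spectrum.\<close>

lemma cstar_neg_unit_pos_eq_0:
  fixes c :: "'a::cstar_algebra"
  assumes "unit_pos (- (cstar c * c))"
  shows "c = 0"
proof -
  define h where "h = c + cstar c"
  define k where "k = scaleC \<i> (c - cstar c)"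
  have h: "cstar h = h" by (simp add: h_def cstar_add cstar_cstar add.commute)
  have k: "cstar k = k"
    by (simp add: k_def cstar_scaleC cstar_diff cstar_cstar scaleC_minus_left flip: scaleC_minus_right)
  have kk: "k * k = - ((c - cstar c) * (c - cstar c))"
    using scaleC_of_real[of "-1" "(c - cstar c) * (c - cstar c)"]
    by (simp add: k_def scaleC_mult_left scaleC_mult_right scaleC_scaleC)
  have "h * h + k * k = 2 *\<^sub>R (c * cstar c + cstar c * c)"
    unfolding kk by (simp add: h_def algebra_simps scaleR_2)
  then have "c * cstar c = (1/2) *\<^sub>R (h * h + k * k) + - (cstar c * c)" by simp
  then have w: "unit_pos (c * cstar c)"
    using assms unit_pos_square[OF h] unit_pos_square[OF k] by (simp only: unit_pos_add unit_pos_scaleR)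
  show ?thesis
  proof (rule ccontr)
    assume "c \<noteq> 0"
    then have t: "norm (c * cstar c) > 0"
      using cstar_identity[of "cstar c"] by (simp add: cstar_cstar)
    obtain z where "(norm (c * cstar c) *\<^sub>R 1 + - (cstar c * c)) * z = 1"
      using unit_pos_shift_right_inverse[OF assms t] by metis
    then have "(norm (c * cstar c) *\<^sub>R 1 - cstar c * c) * z = 1" by simp
    then have "c * cstar c = 0"
      using t by (intro unit_pos_eq_0_of_right_inverse[OF w inverse_unit_minus_swap]) auto
    then show False using t by simp
  qed
qed

text \<open>With \<open>a = b\<^sup>*b\<close>, \<open>\<bar>a\<bar> = sqrt (a\<^sup>2)\<close> and \<open>c = b (\<bar>a\<bar> - a)\<close> one has \<open>c\<^sup>*c = - \<bar>a\<bar> (\<bar>a\<bar> - a)\<^sup>2\<close>,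
  which forces \<open>c = 0\<close> and then \<open>a = \<bar>a\<bar>\<close>.\<close>

lemma unit_pos_cstar_mult:
  fixes b :: "'a::cstar_algebra"
  shows "unit_pos (cstar b * b)"
proof -
  define a where "a = cstar b * b"
  have a: "cstar a = a" by (simp add: a_def cstar_mult cstar_cstar)
  obtain r where r: "cstar r = r" "r * r = a * a" "unit_pos r"
    "\<And>y. (a * a) * y = y * (a * a) \<Longrightarrow> r * y = y * r"
    using unit_pos_sqrt[OF unit_pos_square[OF a]] by metis
  have ra: "r * a = a * r" by (rule r(4)) (simp add: mult.assoc)
  \<comment> \<open>The root \<open>d\<close> turns \<open>g * r * g\<close> into the square of the
    self-adjoint \<open>d * g\<close>.\<close>
  obtain d where d: "cstar d = d" "d * d = r" "\<And>y. r * y = y * r \<Longrightarrow> d * y = y * d"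
    using unit_pos_sqrt[OF r(3)] by metis
  define g where "g = r - a"
  have g: "cstar g = g" by (simp add: g_def cstar_diff a r(1))
  have "r * g = g * r" by (simp add: g_def algebra_simps ra)
  then have dg: "d * g = g * d" by (rule d(3))
  have ag: "a * g = - (r * g)" by (simp add: g_def algebra_simps ra r(2))
  have "cstar (b * g) * (b * g) = g * (a * g)" by (simp add: cstar_mult g a_def mult.assoc)
  also have "\<dots> = - ((d * g) * (d * g))"
    by (metis ag dg d(2) mult.assoc mult_minus_right)
  finally have bg: "- (cstar (b * g) * (b * g)) = (d * g) * (d * g)" by simp
  have dgsa: "cstar (d * g) = d * g" by (simp add: cstar_mult d(1) g dg)
  have "b * g = 0" by (rule cstar_neg_unit_pos_eq_0) (simp only: bg unit_pos_square[OF dgsa])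
  then have "(d * g) * (d * g) = 0" using bg by simp
  then have "d * g = 0" using dgsa by (rule selfadjoint_square_eq_0[rotated])
  then have rg: "r * g = 0" by (metis d(2) mult.assoc mult_zero_right)
  have "g * g = r * g - a * g" by (simp add: g_def algebra_simps)
  then have "g * g = 0" using rg ag by simp
  then have "g = 0" using g by (rule selfadjoint_square_eq_0[rotated])
  then show ?thesis using r(3) by (simp add: g_def a_def)
qed

section \<open>The order on the algebra\<close>

lemma cstar_pos_iff: "cstar_pos a \<longleftrightarrow> unit_pos a"
  unfolding cstar_pos_def using unit_pos_cstar_mult by (metis unit_pos_sqrt)

lemma cstar_pos_selfadjoint: "cstar_pos a \<Longrightarrow> cstar a = a"
  by (auto simp: cstar_pos_def cstar_mult cstar_cstar)

lemma cstar_pos_mult_cstar: "cstar_pos (a * cstar a)"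
  unfolding cstar_pos_def by (metis cstar_cstar)

lemma cstar_pos_0 [simp]: "cstar_pos 0"
  unfolding cstar_pos_def by (metis mult_zero_right)

lemma cstar_pos_add: "cstar_pos a \<Longrightarrow> cstar_pos b \<Longrightarrow> cstar_pos (a + b)"
  by (simp add: cstar_pos_iff unit_pos_add)

lemma cstar_pos_scaleR: "cstar_pos a \<Longrightarrow> r \<ge> 0 \<Longrightarrow> cstar_pos (r *\<^sub>R a)"
  by (simp add: cstar_pos_iff unit_pos_scaleR)

lemma cstar_pos_sum: "(\<And>i. i \<in> I \<Longrightarrow> cstar_pos (f i)) \<Longrightarrow> cstar_pos (sum f I)"
  by (induction I rule: infinite_finite_induct) (simp_all add: cstar_pos_add)

lemma cstar_pos_conj:
  assumes "cstar_pos a"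
  shows "cstar_pos (c * a * cstar c)"
proof -
  obtain b where "a = cstar b * b" using assms by (auto simp: cstar_pos_def)
  then have "c * a * cstar c = cstar (b * cstar c) * (b * cstar c)"
    by (simp add: cstar_mult cstar_cstar mult.assoc)
  then show ?thesis unfolding cstar_pos_def by blast
qed

lemma cstar_pos_norm_minus:
  assumes "cstar a = a" "norm a \<le> t"
  shows "cstar_pos (t *\<^sub>R 1 - a)"
  using assms by (simp add: cstar_pos_iff unit_pos_norm_minus)

text \<open>A bound \<open>M\<close> for the sequence is a common witness for all its terms, and the
  norm inequality with fixed \<open>M\<close> is closed.\<close>

lemma cstar_pos_lim:
  fixes f :: "nat \<Rightarrow> 'a::cstar_algebra"
  assumes "f \<longlonglongrightarrow> l" "\<And>n. cstar_pos (f n)"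
  shows "cstar_pos l"
proof -
  obtain M where M: "M > 0" "\<And>n. norm (f n) \<le> M"
    using convergent_imp_Bseq[OF convergentI[OF assms(1)]] by (auto elim: BseqE)
  have "norm (M *\<^sub>R 1 - l) \<le> M"
  proof (rule LIMSEQ_le_const2)
    show "(\<lambda>n. norm (M *\<^sub>R 1 - f n)) \<longlonglongrightarrow> norm (M *\<^sub>R 1 - l)"
      by (intro tendsto_intros assms(1))
    show "\<exists>N. \<forall>n\<ge>N. norm (M *\<^sub>R 1 - f n) \<le> M"
      using assms(2) M by (auto simp: cstar_pos_iff intro: unit_pos_norm_le)
  qed
  moreover have "(\<lambda>n. cstar (f n)) \<longlonglongrightarrow> cstar l"
    by (rule bounded_linear.tendsto[OF bounded_linear_cstar assms(1)])
  then have "cstar l = l"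
    using assms by (simp add: cstar_pos_selfadjoint LIMSEQ_unique)
  ultimately show ?thesis
    using M by (auto simp: cstar_pos_iff unit_pos_def intro!: exI[of _ M])
qed

lemma cstar_le_trans: "cstar_le a b \<Longrightarrow> cstar_le b c \<Longrightarrow> cstar_le a c"
  unfolding cstar_le_def using cstar_pos_add[of "b - a" "c - b"] by simp

lemma cstar_le_scaleR_mono: "cstar_le a b \<Longrightarrow> r \<ge> 0 \<Longrightarrow> cstar_le (r *\<^sub>R a) (r *\<^sub>R b)"
  unfolding cstar_le_def using cstar_pos_scaleR[of "b - a" r] by (simp add: algebra_simps)

lemma cstar_le_scaleR_right: "cstar_pos a \<Longrightarrow> r \<le> s \<Longrightarrow> cstar_le (r *\<^sub>R a) (s *\<^sub>R a)"
  unfolding cstar_le_def using cstar_pos_scaleR[of a "s - r"] by (simp add: algebra_simps)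

lemma norm_mono_cstar:
  assumes a: "cstar_pos a" and ab: "cstar_le a b"
  shows "norm a \<le> norm b"
proof -
  have b: "cstar_pos b" using cstar_pos_add[OF a ab[unfolded cstar_le_def]] by simp
  have "cstar_pos (norm b *\<^sub>R 1 - b)"
    by (rule cstar_pos_norm_minus[OF cstar_pos_selfadjoint[OF b] order_refl])
  then have "cstar_pos (norm b *\<^sub>R 1 - a)"
    using ab cstar_pos_add[of "norm b *\<^sub>R 1 - b" "b - a"] by (simp add: cstar_le_def)
  then show ?thesis using a by (auto simp: cstar_pos_iff intro: norm_le_of_unit_pos)
qed

lemma cstar_pos_antisym: "cstar_pos a \<Longrightarrow> cstar_pos (- a) \<Longrightarrow> a = 0"
  using norm_mono_cstar[of a 0] by (simp add: cstar_le_def)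

lemma cstar_le_antisym: "cstar_le a b \<Longrightarrow> cstar_le b a \<Longrightarrow> a = b"
  using cstar_pos_antisym[of "b - a"] by (simp add: cstar_le_def)

lemma finite_sum_cstar_le_sums:
  assumes f: "f sums s" and pos: "\<And>j. cstar_pos (f j)" and I: "finite I"
  shows "cstar_le (sum f I) s"
proof -
  obtain N where N: "I \<subseteq> {..<N}" using I finite_nat_bounded by blast
  have "(\<lambda>n. sum f {..<n + N} - sum f I) \<longlonglongrightarrow> s - sum f I"
    using LIMSEQ_ignore_initial_segment[OF f[unfolded sums_def], of N]
    by (intro tendsto_diff tendsto_const)
  moreover have "cstar_pos (sum f {..<n + N} - sum f I)" for n
  proof -
    have "sum f {..<n + N} - sum f I = sum f ({..<n + N} - I)"
      using N by (subst sum_diff) auto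
    then show ?thesis using pos by (simp add: cstar_pos_sum)
  qed
  ultimately show ?thesis unfolding cstar_le_def by (rule cstar_pos_lim)
qed


section \<open>Hilbert modules\<close>

locale cstar_module =
  fixes act :: "'a::cstar_algebra \<Rightarrow> 'h::ab_group_add \<Rightarrow> 'h"
    and ip :: "'h \<Rightarrow> 'h \<Rightarrow> 'a"
  assumes hilbert: "hilbert_module act ip"
begin

text \<open>The module type carries only an additive group, so real scalars act through multiples of
  the unit of the algebra.\<close>

abbreviation scal :: "real \<Rightarrow> 'h \<Rightarrow> 'h" where "scal r \<equiv> act (r *\<^sub>R 1)"

abbreviation hlim :: "(nat \<Rightarrow> 'h) \<Rightarrow> 'h \<Rightarrow> bool" where
  "hlim f l \<equiv> (\<lambda>n. hnorm ip (f n - l)) \<longlonglongrightarrow> 0"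

lemma act_add: "act a (x + y) = act a x + act a y"
  and act_add_left: "act (a + b) x = act a x + act b x"
  and ip_add_left: "ip (x + y) z = ip x z + ip y z"
  and ip_act_left: "ip (act a x) y = a * ip x y"
  and cstar_ip: "cstar (ip x y) = ip y x"
  and ip_pos: "cstar_pos (ip x x)"
  and ip_eq_0: "ip x x = 0 \<Longrightarrow> x = 0"
  and complete: "hcomplete ip"
  using hilbert unfolding hilbert_module_def by metis+

lemma act_0 [simp]: "act a 0 = 0"
  using act_add[of a 0 0] by simp

lemma ip_add_right: "ip x (y + z) = ip x y + ip x z"
  by (metis cstar_add cstar_ip ip_add_left)

lemma ip_act_right: "ip x (act a y) = ip x y * cstar a"
  by (metis cstar_ip cstar_mult ip_act_left)

lemma ip_0_left [simp]: "ip 0 y = 0"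
  using ip_add_left[of 0 0 y] by simp

lemma ip_0_right [simp]: "ip x 0 = 0"
  using ip_add_right[of x 0 0] by simp

lemma ip_minus_left: "ip (- x) y = - ip x y"
  using ip_add_left[of x "- x" y] by (simp add: eq_neg_iff_add_eq_0 add.commute)

lemma ip_minus_right: "ip x (- y) = - ip x y"
  using ip_add_right[of x y "- y"] by (simp add: eq_neg_iff_add_eq_0 add.commute)

lemma ip_diff_left: "ip (x - y) z = ip x z - ip y z"
  using ip_add_left[of x "- y" z] by (simp add: ip_minus_left)

lemma ip_diff_right: "ip z (x - y) = ip z x - ip z y"
  using ip_add_right[of z x "- y"] by (simp add: ip_minus_right)

lemma ip_sum_left: "ip (sum f I) y = (\<Sum>i\<in>I. ip (f i) y)"
  by (induction I rule: infinite_finite_induct) (simp_all add: ip_add_left)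

lemma ip_eqI: "(\<And>z. ip x z = ip y z) \<Longrightarrow> x = y"
  using ip_eq_0[of "x - y"] by (simp add: ip_diff_left)

lemma ip_eqI_right: "(\<And>z. ip z x = ip z y) \<Longrightarrow> x = y"
  by (metis cstar_ip ip_eqI)

lemma ip_scal_left [simp]: "ip (scal r x) y = r *\<^sub>R ip x y"
  by (simp add: ip_act_left)

lemma ip_scal_right [simp]: "ip x (scal r y) = r *\<^sub>R ip x y"
  by (simp add: ip_act_right)

lemma hnorm_nonneg [simp]: "hnorm ip x \<ge> 0"
  by (simp add: hnorm_def)

lemma hnorm_power2: "(hnorm ip x)\<^sup>2 = norm (ip x x)"
  by (simp add: hnorm_def)

lemma hnorm_0 [simp]: "hnorm ip 0 = 0"
  by (simp add: hnorm_def)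

lemma hnorm_eq_0: "hnorm ip x = 0 \<Longrightarrow> x = 0"
  by (simp add: hnorm_def ip_eq_0)

lemma hnorm_scal [simp]: "hnorm ip (scal r x) = \<bar>r\<bar> * hnorm ip x"
  by (simp add: hnorm_def real_sqrt_mult abs_mult flip: power2_eq_square)

lemma hnorm_minus [simp]: "hnorm ip (- x) = hnorm ip x"
  by (simp add: hnorm_def ip_minus_left ip_minus_right)

text \<open>Cauchy--Schwarz, from \<open>\<langle>a x - y, a x - y\<rangle> \<ge> 0\<close> with \<open>a = \<langle>y, x\<rangle>\<close>, after normalizing \<open>x\<close>.\<close>

lemma norm_ip_le: "norm (ip x y) \<le> hnorm ip x * hnorm ip y"
proof (cases "x = 0")
  case False
  have unit: "norm (ip y u) \<le> hnorm ip y" if u: "hnorm ip u = 1" for u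
  proof -
    define a where "a = ip y u"
    have ca: "cstar a = ip u y" by (simp add: a_def cstar_ip)
    have "norm (ip u u) = 1" using u hnorm_power2[of u] by simp
    \<comment> \<open>Norm 1 gives only \<open>ip u u <= 1\<close>, not equality; the defect,
      conjugated by \<open>a\<close>, is added to the expanded square.\<close>
    then have "cstar_pos (1 *\<^sub>R 1 - ip u u)"
      by (intro cstar_pos_norm_minus) (simp_all add: cstar_ip)
    then have 1: "cstar_pos (a * (1 - ip u u) * cstar a)" using cstar_pos_conj by simp
    have 2: "cstar_pos (ip (act a u - y) (act a u - y))" by (rule ip_pos)
    have "ip (act a u - y) (act a u - y) + a * (1 - ip u u) * cstar a = ip y y - a * cstar a"
      by (simp add: ip_diff_left ip_diff_right ip_act_left ip_act_right ca algebra_simps)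
        (simp add: a_def)
    then have "cstar_le (a * cstar a) (ip y y)"
      using cstar_pos_add[OF 2 1] by (simp add: cstar_le_def)
    then have "norm (a * cstar a) \<le> norm (ip y y)" by (rule norm_mono_cstar[OF cstar_pos_mult_cstar])
    moreover have "norm (a * cstar a) = (norm a)\<^sup>2"
      using cstar_identity[of "cstar a"] by (simp add: cstar_cstar)
    ultimately have "(norm a)\<^sup>2 \<le> (hnorm ip y)\<^sup>2" by (simp add: hnorm_power2)
    then show ?thesis unfolding a_def by (rule power2_le_imp_le) simp
  qed
  have pos: "hnorm ip x > 0" using False hnorm_eq_0[of x] hnorm_nonneg[of x] by linarith
  then have "norm (ip y (scal (1 / hnorm ip x) x)) \<le> hnorm ip y"
    by (intro unit) (simp add: field_simps)
  then have "norm (ip y x) \<le> hnorm ip x * hnorm ip y" using pos by (simp add: field_simps)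
  then show ?thesis by (metis cstar_ip norm_cstar)
qed simp

lemma hnorm_triangle: "hnorm ip (x + y) \<le> hnorm ip x + hnorm ip y"
proof (rule power2_le_imp_le)
  have "(hnorm ip (x + y))\<^sup>2 = norm (ip x x + ip x y + (ip y x + ip y y))"
    by (simp add: hnorm_power2 ip_add_left ip_add_right algebra_simps)
  also have "\<dots> \<le> norm (ip x x) + norm (ip x y) + (norm (ip y x) + norm (ip y y))"
    by (intro order_trans[OF norm_triangle_ineq] add_mono norm_triangle_ineq)
  also have "\<dots> \<le> (hnorm ip x)\<^sup>2 + hnorm ip x * hnorm ip y + (hnorm ip y * hnorm ip x + (hnorm ip y)\<^sup>2)"
    by (intro add_mono norm_ip_le) (simp_all add: hnorm_power2)
  also have "\<dots> = (hnorm ip x + hnorm ip y)\<^sup>2" by (simp add: power2_eq_square algebra_simps)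
  finally show "(hnorm ip (x + y))\<^sup>2 \<le> (hnorm ip x + hnorm ip y)\<^sup>2" .
qed simp

lemma hnorm_sum_le: "hnorm ip (sum f I) \<le> (\<Sum>i\<in>I. hnorm ip (f i))"
  by (induction I rule: infinite_finite_induct) (auto intro: order_trans[OF hnorm_triangle])

lemma tendsto_ip_left:
  assumes "hlim f l"
  shows "(\<lambda>n. ip (f n) y) \<longlonglongrightarrow> ip l y"
proof -
  have lim: "(\<lambda>n. hnorm ip (f n - l) * hnorm ip y) \<longlonglongrightarrow> 0"
    using tendsto_mult_left_zero[OF assms, of "hnorm ip y"] by simp
  have "\<forall>\<^sub>F n in sequentially. norm (ip (f n - l) y) \<le> hnorm ip (f n - l) * hnorm ip y"
    by (simp add: norm_ip_le)
  then have "(\<lambda>n. ip (f n - l) y) \<longlonglongrightarrow> 0"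
    using lim by (rule Lim_null_comparison)
  then show ?thesis by (simp add: ip_diff_left LIM_zero_iff)
qed

lemma tendsto_ip_right:
  assumes "hlim f l"
  shows "(\<lambda>n. ip y (f n)) \<longlonglongrightarrow> ip y l"
  using bounded_linear.tendsto[OF bounded_linear_cstar tendsto_ip_left[OF assms, of y]]
  by (simp add: cstar_ip)

lemma hlim_unique: "hlim f l \<Longrightarrow> hlim f l' \<Longrightarrow> l = l'"
  by (rule ip_eqI) (metis tendsto_ip_left LIMSEQ_unique)

text \<open>Blocks \<open>{m..<n}\<close>, empty for \<open>n <= m\<close>, match the form of
  \<open>summable_Cauchy\<close>, from which the hypothesis is verified.\<close>

lemma hlim_sum_exists:
  assumes "\<And>e. e > 0 \<Longrightarrow> \<exists>N. \<forall>m\<ge>N. \<forall>n. hnorm ip (sum f {m..<n}) < e"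
  shows "\<exists>l. hlim (\<lambda>n. sum f {..<n}) l"
proof -
  have "\<exists>N. \<forall>m\<ge>N. \<forall>n\<ge>N. hnorm ip (sum f {..<m} - sum f {..<n}) < e" if e: "e > 0" for e
  proof -
    obtain N where N: "\<And>m n. m \<ge> N \<Longrightarrow> hnorm ip (sum f {m..<n}) < e"
      using assms[OF e] by blast
    have le: "hnorm ip (sum f {..<m} - sum f {..<n}) < e" if "m \<ge> n" "n \<ge> N" for m n
    proof -
      have "sum f {..<m} - sum f {..<n} = sum f {n..<m}"
        using sum_diff_nat_ivl[of 0 n m f] that(1) by (simp add: atLeast0LessThan)
      then show ?thesis using N that by simp
    qed
    have "hnorm ip (sum f {..<m} - sum f {..<n}) < e" if "m \<ge> N" "n \<ge> N" for m n
    proof (cases "m \<ge> n")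
      case False
      then have "hnorm ip (sum f {..<n} - sum f {..<m}) < e" using that by (intro le) auto
      then show ?thesis using hnorm_minus[of "sum f {..<n} - sum f {..<m}"] by simp
    qed (use le that in auto)
    then show ?thesis by blast
  qed
  then have "\<forall>e>0. \<exists>N. \<forall>m\<ge>N. \<forall>n\<ge>N. hnorm ip (sum f {..<m} - sum f {..<n}) < e" by simp
  then show ?thesis by (rule complete[unfolded hcomplete_def, THEN spec, THEN mp])
qed

lemma adjoint_swap: "is_adjoint ip ip T Ts \<Longrightarrow> is_adjoint ip ip Ts T"
  unfolding is_adjoint_def by (metis (no_types, lifting) cstar_ip)

text \<open>Polarization; this uses the complex scalars of the algebra.\<close>

lemma selfadjoint_eq_id:
  assumes W: "is_adjoint ip ip W W" and diag: "\<And>z. ip (W z) z = ip z z"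
  shows "W z = z"
proof -
  have W': "ip (W x) y = ip x (W y)" for x y using W unfolding is_adjoint_def by blast
  define B where "B x y = ip (W x) y - ip x y" for x y
  have B0: "B x x = 0" for x by (simp add: B_def diag)
  have addl: "B (x + y) w = B x w + B y w" for x y w
    unfolding B_def W' by (simp add: ip_add_left)
  have addr: "B w (x + y) = B w x + B w y" for x y w
    unfolding B_def by (simp add: ip_add_right)
  have actl: "B (act a x) w = a * B x w" for a x w
    unfolding B_def W' by (simp add: ip_act_left algebra_simps)
  have actr: "B w (act a x) = B w x * cstar a" for a x w
    unfolding B_def by (simp add: ip_act_right algebra_simps)
  have anti: "B x y = - B y x" for x y
  proof -
    have "B (x + y) (x + y) = B x y + B y x" by (simp only: addl addr B0[of x] B0[of y]) simp
    then show ?thesis by (simp only: B0 eq_neg_iff_add_eq_0)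
  qed
  have "B x y = 0" for x y
  proof -
    \<comment> \<open>Replacing \<open>x\<close> by \<open>i x\<close> turns antisymmetry into
      symmetry, since \<open>i\<close> leaves the second argument conjugated.\<close>
    have "scaleC \<i> (B x y) = scaleC \<i> 1 * B x y" by (simp add: scaleC_mult_left)
    also have "\<dots> = B (act (scaleC \<i> 1) x) y" by (simp add: actl)
    also have "\<dots> = - (B y x * cstar (scaleC \<i> 1))" by (simp add: anti[of "act (scaleC \<i> 1) x"] actr)
    also have "\<dots> = scaleC \<i> (B y x)"
      by (simp add: cstar_scaleC scaleC_minus_left scaleC_mult_right)
    finally have "scaleC \<i> (scaleC \<i> (B x y)) = scaleC \<i> (scaleC \<i> (B y x))" by simp
    then have "B x y = B y x" by (simp add: scaleC_i_i)
    then have "2 *\<^sub>R B x y = 0" using anti[of x y] by (metis add.left_inverse scaleR_2)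
    then show ?thesis by simp
  qed
  then show ?thesis by (intro ip_eqI) (simp add: B_def)
qed

end

text \<open>Reordering of the double series \<open>\<Sum>\<^sub>m \<Sum>\<^sub>n d\<^sub>m d\<^sub>n g\<^sub>m\<^sub>+\<^sub>n\<close> along the diagonals \<open>m + n = N\<close>.\<close>

lemma double_sums_convolution:
  fixes g h :: "nat \<Rightarrow> 'a::banach" and d :: "nat \<Rightarrow> real"
  assumes g: "\<And>n. norm (g n) \<le> c * q ^ n" and q: "0 \<le> q" "q < 1"
    and d: "\<And>n. \<bar>d n\<bar> \<le> 1" and conv: "\<And>n. (\<Sum>k\<le>n. d k * d (n - k)) = 1"
    and h: "\<And>m. (\<lambda>n. d n *\<^sub>R g (m + n)) sums h m"
    and s: "(\<lambda>m. d m *\<^sub>R h m) sums s"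
  shows "g sums s"
proof -
  define F where "F = (\<lambda>(m, n). (d m * d n) *\<^sub>R g (m + n))"
  have "c * q ^ 0 \<ge> 0" using g[of 0] norm_ge_zero order_trans by blast
  then have c: "c \<ge> 0" by simp
  have geo: "((\<lambda>n. q ^ n) has_sum (1 / (1 - q))) UNIV"
    using q by (intro sums_nonneg_imp_has_sum geometric_sums) auto
  have "(\<lambda>(m, n). c * q ^ m * q ^ n) summable_on UNIV \<times> UNIV"
  proof (rule summable_on_SigmaI)
    show "((\<lambda>n. case (m, n) of (m, n) \<Rightarrow> c * q ^ m * q ^ n) has_sum (c * q ^ m * (1 / (1 - q)))) UNIV" for m
      using has_sum_cmult_right[OF geo, of "c * q ^ m"] by simp
    show "(\<lambda>m. c * q ^ m * (1 / (1 - q))) summable_on UNIV"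
      using has_sum_imp_summable[OF geo] by (intro summable_on_cmult_left summable_on_cmult_right)
  qed (use c q in auto)
  moreover have "norm (F p) \<le> (case p of (m, n) \<Rightarrow> c * q ^ m * q ^ n)" for p
  proof -
    obtain m n where p: "p = (m, n)" by (cases p)
    have "\<bar>d m * d n\<bar> * norm (g (m + n)) \<le> 1 * (c * q ^ (m + n))"
      using d g by (intro mult_mono) (auto simp: abs_mult intro: mult_le_one)
    then show ?thesis by (simp add: F_def p power_add mult.assoc)
  qed
  ultimately have "(\<lambda>p. norm (F p)) summable_on UNIV \<times> UNIV"
    by (rule summable_on_comparison_test) auto
  then have Fs: "F summable_on UNIV \<times> UNIV" by (rule abs_summable_summable)
  then obtain S where S: "(F has_sum S) (UNIV \<times> UNIV)" by (auto simp: summable_on_def)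
  \<comment> \<open>Summed by rows the family gives \<open>s\<close>; summed by diagonals further
    below it gives the series of \<open>g\<close>.\<close>
  have "((\<lambda>m. d m *\<^sub>R h m) has_sum S) UNIV"
  proof (rule has_sum_SigmaD[OF S])
    fix m
    have "(\<lambda>n. norm (d n *\<^sub>R g (m + n))) sums (\<Sum>n. norm (d n *\<^sub>R g (m + n)))"
    proof (rule summable_sums, rule summable_comparison_test'[where N = 0])
      show "summable (\<lambda>n. c * q ^ m * q ^ n)" using q by (intro summable_mult summable_geometric) simp
      show "norm (norm (d n *\<^sub>R g (m + n))) \<le> c * q ^ m * q ^ n" for n
        using mult_mono[OF d[of n] g[of "m + n"]] by (simp add: power_add mult.assoc)
    qed
    then have "((\<lambda>n. d n *\<^sub>R g (m + n)) has_sum h m) UNIV"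
      by (intro norm_summable_imp_has_sum h) (rule sums_summable)
    then have "((\<lambda>n. d m *\<^sub>R (d n *\<^sub>R g (m + n))) has_sum d m *\<^sub>R h m) UNIV"
      by (rule has_sum_scaleR)
    then show "((\<lambda>n. F (m, n)) has_sum d m *\<^sub>R h m) UNIV" by (simp add: F_def)
  qed
  then have sS: "s = S" using s has_sum_imp_sums sums_unique2 by blast
  have "((\<lambda>(N, k). F (k, N - k)) has_sum S) (Sigma UNIV (\<lambda>N. {..N}))"
    using S by (subst has_sum_reindex_bij_witness[where T = "UNIV \<times> UNIV" and h = F
          and i = "\<lambda>(m, n). (m + n, m)" and j = "\<lambda>(N, k). (k, N - k)"]) auto
  then have "(g has_sum S) UNIV"
  proof (rule has_sum_SigmaD)
    fix N
    have "(\<Sum>k\<le>N. F (k, N - k)) = (\<Sum>k\<le>N. d k * d (N - k)) *\<^sub>R g N"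
      by (simp add: F_def scaleR_sum_left)
    then show "((\<lambda>k. case (N, k) of (N, k) \<Rightarrow> F (k, N - k)) has_sum g N) {..N}"
      using has_sum_finite[of "{..N}" "\<lambda>k. F (k, N - k)"] by (simp add: conv)
  qed
  then show ?thesis using sS by (simp add: has_sum_imp_sums)
qed

section \<open>Power series of a contraction on the module\<close>

context cstar_module
begin

lemma hnorm_funpow_le:
  assumes "0 \<le> q" and K: "\<And>x. hnorm ip (K x) \<le> q * hnorm ip x"
  shows "hnorm ip ((K ^^ n) x) \<le> q ^ n * hnorm ip x"
proof (induction n)
  case (Suc n)
  have "hnorm ip ((K ^^ Suc n) x) \<le> q * hnorm ip ((K ^^ n) x)" using K by simp
  also have "\<dots> \<le> q * (q ^ n * hnorm ip x)" using Suc assms(1) by (rule mult_left_mono)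
  finally show ?case by simp
qed simp

text \<open>Comparison with a geometric series. The conclusion is stated inside \<open>ip\<close>,
  so that later series live in the algebra, where \<open>sums\<close> applies.\<close>

lemma contraction_power_series:
  assumes q: "0 \<le> q" "q < 1" and K: "\<And>x. hnorm ip (K x) \<le> q * hnorm ip x"
    and d: "\<And>n. \<bar>d n\<bar> \<le> 1"
  obtains R where "\<And>x y. (\<lambda>n. d n *\<^sub>R ip ((K ^^ n) x) y) sums ip (R x) y"
proof -
  have "\<exists>l. hlim (\<lambda>N. \<Sum>n<N. scal (d n) ((K ^^ n) x)) l" for x
  proof (rule hlim_sum_exists)
    fix e :: real assume e: "e > 0"
    have "summable (\<lambda>n. q ^ n * hnorm ip x)" using q by (intro summable_mult2 summable_geometric) simp
    then obtain N where N: "\<And>m n. m \<ge> N \<Longrightarrow> norm (\<Sum>i=m..<n. q ^ i * hnorm ip x) < e"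
      using e unfolding summable_Cauchy by blast
    have "hnorm ip (\<Sum>i=m..<n. scal (d i) ((K ^^ i) x)) < e" if "m \<ge> N" for m n
    proof -
      have "hnorm ip (\<Sum>i=m..<n. scal (d i) ((K ^^ i) x))
        \<le> (\<Sum>i=m..<n. hnorm ip (scal (d i) ((K ^^ i) x)))" by (rule hnorm_sum_le)
      also have "\<dots> \<le> (\<Sum>i=m..<n. q ^ i * hnorm ip x)"
      proof (rule sum_mono)
        fix i
        have "\<bar>d i\<bar> * hnorm ip ((K ^^ i) x) \<le> 1 * (q ^ i * hnorm ip x)"
          by (intro mult_mono d hnorm_funpow_le q K) simp_all
        then show "hnorm ip (scal (d i) ((K ^^ i) x)) \<le> q ^ i * hnorm ip x" by simp
      qed
      also have "\<dots> < e" using N[OF that, of n] by simp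
      finally show ?thesis .
    qed
    then show "\<exists>N. \<forall>m\<ge>N. \<forall>n. hnorm ip (\<Sum>i=m..<n. scal (d i) ((K ^^ i) x)) < e" by blast
  qed
  then obtain R where R: "\<And>x. hlim (\<lambda>N. \<Sum>n<N. scal (d n) ((K ^^ n) x)) (R x)" by metis
  show ?thesis
  proof (rule that)
    show "(\<lambda>n. d n *\<^sub>R ip ((K ^^ n) x) y) sums ip (R x) y" for x y
      using tendsto_ip_left[OF R[of x], of y] by (simp add: sums_def ip_sum_left)
  qed
qed

lemma funpow_selfadjoint:
  assumes "is_adjoint ip ip K K"
  shows "ip ((K ^^ n) x) y = ip x ((K ^^ n) y)"
proof (induction n arbitrary: x)
  case (Suc n)
  have "ip ((K ^^ Suc n) x) y = ip ((K ^^ n) (K x)) y" by (simp add: funpow_swap1)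
  also have "\<dots> = ip x (K ((K ^^ n) y))" using Suc assms by (simp add: is_adjoint_def)
  finally show ?case by simp
qed simp

lemma power_series_selfadjoint:
  assumes K: "is_adjoint ip ip K K"
    and R: "\<And>x y. (\<lambda>n. d n *\<^sub>R ip ((K ^^ n) x) y) sums ip (R x) y"
  shows "is_adjoint ip ip R R"
  unfolding is_adjoint_def
proof (intro allI)
  fix x y
  have "(\<lambda>n. cstar (d n *\<^sub>R ip ((K ^^ n) y) x)) sums cstar (ip (R y) x)"
    by (rule bounded_linear.sums[OF bounded_linear_cstar R])
  then have "(\<lambda>n. d n *\<^sub>R ip ((K ^^ n) x) y) sums ip x (R y)"
    by (simp add: cstar_ip funpow_selfadjoint[OF K])
  then show "ip (R x) y = ip x (R y)" using R sums_unique2 by blast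
qed

text \<open>\<open>R = (1 - K)\<^bsup>-1/2\<^esup>\<close>, the series with coefficients \<^const>\<open>isqrt_coeff\<close>.\<close>

lemma contraction_inverse_sqrt:
  assumes K: "is_adjoint ip ip K K" and q: "0 \<le> q" "q < 1"
    and Kq: "\<And>x. hnorm ip (K x) \<le> q * hnorm ip x"
  obtains V R where "is_adjoint ip ip R R" "V = R \<circ> R" "\<And>x. V x - K (V x) = x"
proof -
  obtain R where R: "\<And>x y. (\<lambda>n. isqrt_coeff n *\<^sub>R ip ((K ^^ n) x) y) sums ip (R x) y"
    using contraction_power_series[OF q Kq, of isqrt_coeff] isqrt_coeff_bounds by (metis abs_of_nonneg)
  have Rsa: "is_adjoint ip ip R R" using K R by (rule power_series_selfadjoint)
  have K': "ip (K x) y = ip x (K y)" for x y using K unfolding is_adjoint_def by blast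
  have Kn: "norm (ip ((K ^^ n) x) y) \<le> hnorm ip x * hnorm ip y * q ^ n" for n x y
  proof -
    have "hnorm ip ((K ^^ n) x) * hnorm ip y \<le> q ^ n * hnorm ip x * hnorm ip y"
      by (intro mult_right_mono hnorm_funpow_le q Kq) simp
    then show ?thesis using norm_ip_le[of "(K ^^ n) x" y] by (simp add: mult_ac)
  qed
  \<comment> \<open>The convolution lemma with \<open>g n = ip ((K ^^ n) x) y\<close> and
    \<open>h m = ip ((K ^^ m) (R x)) y\<close>: the square of \<open>R\<close> is the Neumann series
    of \<open>K\<close>.\<close>
  have V: "(\<lambda>n. ip ((K ^^ n) x) y) sums ip (R (R x)) y" for x y
  proof (rule double_sums_convolution[OF Kn q])
    show "\<bar>isqrt_coeff n\<bar> \<le> 1" for n using isqrt_coeff_bounds[of n] by simp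
    show "(\<Sum>k\<le>n. isqrt_coeff k * isqrt_coeff (n - k)) = 1" for n by (rule convolution_isqrt_coeff)
    show "(\<lambda>n. isqrt_coeff n *\<^sub>R ip ((K ^^ (m + n)) x) y) sums ip ((K ^^ m) (R x)) y" for m
      using R[of x "(K ^^ m) y"]
      by (simp add: funpow_add funpow_selfadjoint[OF K, of m])
    show "(\<lambda>m. isqrt_coeff m *\<^sub>R ip ((K ^^ m) (R x)) y) sums ip (R (R x)) y" by (rule R)
  qed
  have inv: "R (R x) - K (R (R x)) = x" for x
  proof (rule ip_eqI)
    fix y
    \<comment> \<open>Moving one \<open>K\<close> onto \<open>y\<close> shifts the Neumann series by
      one; the missing first term is \<open>ip x y\<close>.\<close>
    have "(\<lambda>n. ip ((K ^^ Suc n) x) y) sums ip (K (R (R x))) y"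
      using V[of x "K y"] by (simp add: K')
    then have "(\<lambda>n. ip ((K ^^ n) x) y) sums (ip (K (R (R x))) y + ip x y)"
      using sums_Suc_iff[of "\<lambda>n. ip ((K ^^ n) x) y"] by simp
    then have "ip (R (R x)) y = ip (K (R (R x))) y + ip x y" using V sums_unique2 by blast
    then show "ip (R (R x) - K (R (R x))) y = ip x y" by (simp add: ip_diff_left)
  qed
  show ?thesis using that[of R "R \<circ> R"] Rsa inv by simp
qed

end

section \<open>Frames\<close>

locale cstar_frame = cstar_module act ip
  for act :: "'a::cstar_algebra \<Rightarrow> 'h::ab_group_add \<Rightarrow> 'h" and ip :: "'h \<Rightarrow> 'h \<Rightarrow> 'a" +
  fixes ys :: "nat \<Rightarrow> 'h" and C D :: real
  assumes C: "0 < C" and CD: "C \<le> D"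
    and frame_sums: "\<And>x. (\<lambda>j. ip x (ys j) * ip (ys j) x) sums (\<Sum>j. ip x (ys j) * ip (ys j) x)"
    and frame_lower: "\<And>x. cstar_le (C *\<^sub>R ip x x) (\<Sum>j. ip x (ys j) * ip (ys j) x)"
    and frame_upper: "\<And>x. cstar_le (\<Sum>j. ip x (ys j) * ip (ys j) x) (D *\<^sub>R ip x x)"
begin

lemma D: "0 < D"
  using C CD by simp

lemma frame_term_pos: "cstar_pos (ip x (ys j) * ip (ys j) x)"
  using cstar_pos_mult_cstar[of "ip x (ys j)"] by (simp add: cstar_ip)

text \<open>Here \<open>y = \<Sum> b\<^sub>j x\<^sub>j\<close>; expand \<open>\<Sum> (D b\<^sub>j - \<langle>y, x\<^sub>j\<rangle>) (D b\<^sub>j - \<langle>y, x\<^sub>j\<rangle>)\<^sup>* \<ge> 0\<close>.\<close>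

lemma synthesis_le:
  fixes b :: "nat \<Rightarrow> 'a"
  assumes I: "finite I"
  defines "y \<equiv> \<Sum>j\<in>I. act (b j) (ys j)"
  shows "cstar_le (ip y y) (D *\<^sub>R (\<Sum>j\<in>I. b j * cstar (b j)))"
proof -
  define B where "B = (\<Sum>j\<in>I. b j * cstar (b j))"
  define E where "E = (\<Sum>j\<in>I. ip y (ys j) * ip (ys j) y)"
  have yy: "(\<Sum>j\<in>I. b j * ip (ys j) y) = ip y y"
    unfolding y_def by (simp add: ip_sum_left ip_act_left)
  have yy': "(\<Sum>j\<in>I. ip y (ys j) * cstar (b j)) = ip y y"
    using arg_cong[OF yy, of cstar] by (simp add: cstar_sum cstar_mult cstar_ip)
  have "cstar_pos (\<Sum>j\<in>I. (D *\<^sub>R b j - ip y (ys j)) * cstar (D *\<^sub>R b j - ip y (ys j)))"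
    by (intro cstar_pos_sum cstar_pos_mult_cstar)
  also have "(\<Sum>j\<in>I. (D *\<^sub>R b j - ip y (ys j)) * cstar (D *\<^sub>R b j - ip y (ys j)))
    = (\<Sum>j\<in>I. (D * D) *\<^sub>R (b j * cstar (b j)) - D *\<^sub>R (b j * ip (ys j) y)
         - D *\<^sub>R (ip y (ys j) * cstar (b j)) + ip y (ys j) * ip (ys j) y)"
    by (rule sum.cong) (simp_all add: cstar_diff cstar_ip algebra_simps)
  also have "\<dots> = (D * D) *\<^sub>R B - D *\<^sub>R ip y y - D *\<^sub>R ip y y + E"
    by (simp only: sum.distrib sum_subtractf B_def E_def yy yy' flip: scaleR_sum_right)
  finally have 1: "cstar_pos ((D * D) *\<^sub>R B - D *\<^sub>R ip y y - D *\<^sub>R ip y y + E)" .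
  have "cstar_le E (\<Sum>j. ip y (ys j) * ip (ys j) y)"
    unfolding E_def by (rule finite_sum_cstar_le_sums[OF frame_sums frame_term_pos I])
  then have "cstar_le E (D *\<^sub>R ip y y)" using frame_upper cstar_le_trans by blast
  then have "cstar_pos (((D * D) *\<^sub>R B - D *\<^sub>R ip y y - D *\<^sub>R ip y y + E) + (D *\<^sub>R ip y y - E))"
    using 1 cstar_pos_add unfolding cstar_le_def by blast
  then have "cstar_pos ((1 / D) *\<^sub>R ((D * D) *\<^sub>R B - D *\<^sub>R ip y y))"
    using D by (intro cstar_pos_scaleR) simp_all
  moreover have "(1 / D) *\<^sub>R ((D * D) *\<^sub>R B - D *\<^sub>R ip y y) = D *\<^sub>R B - ip y y"
    using D by (simp add: scaleR_right_diff_distrib)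
  ultimately show ?thesis by (simp add: cstar_le_def B_def)
qed

text \<open>By \<open>synthesis_le\<close>, the squared norm of each block is at most
  \<open>D\<close> times the norm of the same block of the coefficient series.\<close>

lemma synthesis_exists:
  assumes b: "summable (\<lambda>j. b j * cstar (b j))"
  shows "\<exists>l. hlim (\<lambda>n. \<Sum>j<n. act (b j) (ys j)) l"
proof (rule hlim_sum_exists)
  fix e :: real assume e: "e > 0"
  have "e\<^sup>2 / D > 0" using e D by simp
  then obtain N where N: "\<And>m n. m \<ge> N \<Longrightarrow> norm (\<Sum>j=m..<n. b j * cstar (b j)) < e\<^sup>2 / D"
    using b unfolding summable_Cauchy by blast
  have "hnorm ip (\<Sum>j=m..<n. act (b j) (ys j)) < e" if "m \<ge> N" for m n
  proof -
    define y where "y = (\<Sum>j=m..<n. act (b j) (ys j))"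
    have "norm (ip y y) \<le> norm (D *\<^sub>R (\<Sum>j=m..<n. b j * cstar (b j)))"
      unfolding y_def by (intro norm_mono_cstar ip_pos synthesis_le) simp
    also have "\<dots> < D * (e\<^sup>2 / D)" using mult_strict_left_mono[OF N[OF that] D] D by simp
    finally have "(hnorm ip y)\<^sup>2 < e\<^sup>2" using D by (simp add: hnorm_power2)
    then show ?thesis using e unfolding y_def by (simp add: power2_less_imp_less)
  qed
  then show "\<exists>N. \<forall>m\<ge>N. \<forall>n. hnorm ip (\<Sum>j=m..<n. act (b j) (ys j)) < e" by blast
qed

text \<open>On \<open>l2\<close> this is the adjoint of the frame transform; only there is a limit
  guaranteed to exist.\<close>

definition synthesis :: "(nat \<Rightarrow> 'a) \<Rightarrow> 'h" where
  "synthesis b = (SOME l. hlim (\<lambda>n. \<Sum>j<n. act (b j) (ys j)) l)"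

lemma hlim_synthesis:
  "summable (\<lambda>j. b j * cstar (b j)) \<Longrightarrow> hlim (\<lambda>n. \<Sum>j<n. act (b j) (ys j)) (synthesis b)"
  unfolding synthesis_def by (rule someI_ex[OF synthesis_exists])

lemma ip_synthesis:
  assumes "summable (\<lambda>j. b j * cstar (b j))"
  shows "(\<lambda>j. ip x (ys j) * cstar (b j)) sums ip x (synthesis b)"
proof -
  have "(\<lambda>n. cstar (\<Sum>j<n. b j * ip (ys j) x)) \<longlonglongrightarrow> cstar (ip (synthesis b) x)"
    using tendsto_ip_left[OF hlim_synthesis[OF assms], of x]
    by (intro bounded_linear.tendsto[OF bounded_linear_cstar]) (simp add: ip_sum_left ip_act_left)
  then show ?thesis by (simp add: sums_def cstar_sum cstar_mult cstar_ip)
qed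

lemma analysis_summable: "summable (\<lambda>j. ip x (ys j) * cstar (ip x (ys j)))"
  using sums_summable[OF frame_sums] by (simp add: cstar_ip)

text \<open>The product of the adjoint of the frame transform with the transform itself.\<close>

definition frame_op :: "'h \<Rightarrow> 'h" where
  "frame_op x = synthesis (\<lambda>j. ip x (ys j))"

lemma hlim_frame_op: "hlim (\<lambda>n. \<Sum>j<n. act (ip x (ys j)) (ys j)) (frame_op x)"
  unfolding frame_op_def by (rule hlim_synthesis[OF analysis_summable])

lemma ip_frame_op: "(\<lambda>j. ip x (ys j) * ip (ys j) y) sums ip x (frame_op y)"
  using ip_synthesis[OF analysis_summable, of x y] by (simp add: frame_op_def cstar_ip)

lemma frame_op_selfadjoint: "ip (frame_op x) y = ip x (frame_op y)"
proof -
  have "(\<lambda>j. cstar (ip y (ys j) * ip (ys j) x)) sums cstar (ip y (frame_op x))"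
    by (rule bounded_linear.sums[OF bounded_linear_cstar ip_frame_op])
  then have "(\<lambda>j. ip x (ys j) * ip (ys j) y) sums ip (frame_op x) y"
    by (simp add: cstar_mult cstar_ip)
  then show ?thesis using ip_frame_op sums_unique2 by blast
qed

lemma suminf_frame_terms: "(\<Sum>j. ip x (ys j) * ip (ys j) x) = ip (frame_op x) x"
  using ip_frame_op[of x x] by (simp add: sums_iff frame_op_selfadjoint)

lemma frame_op_lower: "cstar_le (C *\<^sub>R ip x x) (ip (frame_op x) x)"
  using frame_lower by (simp add: suminf_frame_terms)

text \<open>Apply \<open>synthesis_le\<close> to the partial sums with coefficients
  \<open>ip x (ys j)\<close>, then pass to the limit in the closed cone.\<close>

lemma frame_op_square_upper: "cstar_le (ip (frame_op x) (frame_op x)) (D *\<^sub>R ip (frame_op x) x)"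
proof -
  define y where "y n = (\<Sum>j<n. act (ip x (ys j)) (ys j))" for n
  have y: "hlim y (frame_op x)" unfolding y_def by (rule hlim_frame_op)
  have "(\<lambda>n. ip (y n - frame_op x) (y n - frame_op x)) \<longlonglongrightarrow> 0"
  proof (rule Lim_null_comparison)
    show "(\<lambda>n. hnorm ip (y n - frame_op x) * hnorm ip (y n - frame_op x)) \<longlonglongrightarrow> 0"
      using tendsto_mult[OF y y] by simp
  qed (simp add: norm_ip_le)
  moreover have "(\<lambda>n. ip (y n) (frame_op x)) \<longlonglongrightarrow> ip (frame_op x) (frame_op x)"
    by (rule tendsto_ip_left[OF y])
  moreover have "(\<lambda>n. ip (frame_op x) (y n)) \<longlonglongrightarrow> ip (frame_op x) (frame_op x)"
    by (rule tendsto_ip_right[OF y])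
  \<comment> \<open>Once expanded, everything but \<open>ip (y n) (y n)\<close> cancels, so
    continuity of \<open>ip\<close> in each argument separately suffices.\<close>
  ultimately have "(\<lambda>n. ip (y n - frame_op x) (y n - frame_op x) + ip (y n) (frame_op x)
      + ip (frame_op x) (y n) - ip (frame_op x) (frame_op x))
    \<longlonglongrightarrow> 0 + ip (frame_op x) (frame_op x) + ip (frame_op x) (frame_op x) - ip (frame_op x) (frame_op x)"
    by (intro tendsto_add tendsto_diff tendsto_const)
  then have yy: "(\<lambda>n. ip (y n) (y n)) \<longlonglongrightarrow> ip (frame_op x) (frame_op x)"
    by (simp add: ip_diff_left ip_diff_right)
  have terms: "(\<lambda>n. \<Sum>j<n. ip x (ys j) * cstar (ip x (ys j))) \<longlonglongrightarrow> ip (frame_op x) x"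
    using frame_sums[of x] by (simp add: sums_def cstar_ip suminf_frame_terms)
  have "cstar_pos (D *\<^sub>R (\<Sum>j<n. ip x (ys j) * cstar (ip x (ys j))) - ip (y n) (y n))" for n
    using synthesis_le[of "{..<n}"] unfolding y_def cstar_le_def by simp
  then show ?thesis
    unfolding cstar_le_def
    by (intro cstar_pos_lim[OF tendsto_diff[OF tendsto_scaleR[OF tendsto_const terms] yy]])
qed

text \<open>Expand \<open>\<langle>(F - C) x, (F - C) x\<rangle> \<ge> 0\<close> for the frame operator \<open>F\<close>.\<close>

lemma frame_op_square_lower: "cstar_le (C *\<^sub>R ip (frame_op x) x) (ip (frame_op x) (frame_op x))"
proof -
  have 1: "cstar_pos (ip (frame_op x - scal C x) (frame_op x - scal C x))" by (rule ip_pos)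
  have 2: "cstar_pos (C *\<^sub>R (ip (frame_op x) x - C *\<^sub>R ip x x))"
    using frame_op_lower[of x] C by (intro cstar_pos_scaleR) (simp_all add: cstar_le_def)
  have "ip (frame_op x - scal C x) (frame_op x - scal C x) + C *\<^sub>R (ip (frame_op x) x - C *\<^sub>R ip x x)
    = ip (frame_op x) (frame_op x) - C *\<^sub>R ip (frame_op x) x"
    by (simp add: ip_diff_left ip_diff_right algebra_simps frame_op_selfadjoint[of x x, symmetric])
  then show ?thesis using cstar_pos_add[OF 1 2] by (simp add: cstar_le_def)
qed

section \<open>Inverting the frame operator\<close>

lemma frame_op_inj: "frame_op x = frame_op y \<Longrightarrow> x = y"
proof -
  assume "frame_op x = frame_op y"
  then have "ip (frame_op (x - y)) (x - y) = 0"
    by (simp add: frame_op_selfadjoint ip_diff_left) (simp add: ip_diff_left flip: frame_op_selfadjoint)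
  then have "cstar_le (C *\<^sub>R ip (x - y) (x - y)) 0" using frame_op_lower by metis
  then have "norm (C *\<^sub>R ip (x - y) (x - y)) \<le> norm (0::'a)"
    using C by (intro norm_mono_cstar cstar_pos_scaleR ip_pos) auto
  then have "ip (x - y) (x - y) = 0" using C by (simp add: mult_le_0_iff)
  then show "x = y" using ip_eq_0 by fastforce
qed

definition contr :: "'h \<Rightarrow> 'h" where
  "contr x = x - scal (1 / D) (frame_op x)"

lemma contr_selfadjoint: "is_adjoint ip ip contr contr"
  by (simp add: is_adjoint_def contr_def ip_diff_left ip_diff_right frame_op_selfadjoint)

text \<open>Writing \<open>F\<close> for \<open>frame_op\<close>: in the expanded square,
  \<open>F^2 <= D F\<close> lets half of the linear term absorb the quadratic one, and
  \<open>F >= C\<close> bounds the rest.\<close>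

lemma hnorm_contr_le: "hnorm ip (contr x) \<le> sqrt (1 - C / D) * hnorm ip x"
proof -
  have le: "cstar_le (ip (contr x) (contr x)) ((1 - C / D) *\<^sub>R ip x x)"
  proof -
    have 1: "cstar_pos ((1 / D)\<^sup>2 *\<^sub>R (D *\<^sub>R ip (frame_op x) x - ip (frame_op x) (frame_op x)))"
      using frame_op_square_upper[of x] by (intro cstar_pos_scaleR) (simp_all add: cstar_le_def)
    have 2: "cstar_pos ((1 / D) *\<^sub>R (ip (frame_op x) x - C *\<^sub>R ip x x))"
      using frame_op_lower[of x] D by (intro cstar_pos_scaleR) (simp_all add: cstar_le_def)
    have "(1 / D)\<^sup>2 *\<^sub>R (D *\<^sub>R ip (frame_op x) x - ip (frame_op x) (frame_op x))
        + (1 / D) *\<^sub>R (ip (frame_op x) x - C *\<^sub>R ip x x)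
      = (1 - C / D) *\<^sub>R ip x x - ip (contr x) (contr x)"
      using D by (simp add: contr_def ip_diff_left ip_diff_right algebra_simps power2_eq_square
          frame_op_selfadjoint[of x x, symmetric])
    then show ?thesis using cstar_pos_add[OF 1 2] by (simp add: cstar_le_def)
  qed
  have "0 \<le> 1 - C / D" using CD D by simp
  then have "norm (ip (contr x) (contr x)) \<le> (1 - C / D) * norm (ip x x)"
    using norm_mono_cstar[OF ip_pos le] by simp
  then show ?thesis unfolding hnorm_def by (simp flip: real_sqrt_mult)
qed

text \<open>Since \<open>1 - contr\<close> is \<open>frame_op / D\<close>, the operator
  \<open>V / D\<close> is a right inverse, and injectivity makes it two-sided. Dividing
  \<open>R\<close> by \<open>sqrt D\<close> gives a square root of it.\<close>

lemma frame_op_inverse: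
  obtains S R where "\<And>x. frame_op (S x) = x" "\<And>x. S (frame_op x) = x"
    "\<And>x y. ip (S x) y = ip x (S y)" "is_adjoint ip ip R R" "S = R \<circ> R"
proof -
  have q: "0 \<le> sqrt (1 - C / D)" "sqrt (1 - C / D) < 1"
    using C CD D by simp_all
  obtain V R where R: "is_adjoint ip ip R R" "V = R \<circ> R" "\<And>x. V x - contr (V x) = x"
    using contraction_inverse_sqrt[OF contr_selfadjoint q hnorm_contr_le] by metis
  have R': "ip (R x) y = ip x (R y)" for x y using R(1) unfolding is_adjoint_def by blast
  have Rscal: "R (scal r x) = scal r (R x)" for r x
    by (rule ip_eqI) (simp add: R')
  define Q where "Q x = scal (1 / sqrt D) (R x)" for x
  define S where "S = Q \<circ> Q"
  have Q: "is_adjoint ip ip Q Q"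
    by (simp add: is_adjoint_def Q_def R')
  have S: "S x = scal (1 / D) (V x)" for x
  proof (rule ip_eqI)
    show "ip (S x) y = ip (scal (1 / D) (V x)) y" for y
      using D by (simp add: S_def Q_def R Rscal)
  qed
  have frame_scal: "frame_op (scal r x) = scal r (frame_op x)" for r x
    by (rule ip_eqI) (simp add: frame_op_selfadjoint)
  have FS: "frame_op (S x) = x" for x
    using R(3)[of x] by (simp add: S frame_scal contr_def)
  show ?thesis
  proof (rule that[of S Q])
    show "frame_op (S x) = x" for x by (rule FS)
    show "S (frame_op x) = x" for x by (rule frame_op_inj) (rule FS)
    show "ip (S x) y = ip x (S y)" for x y by (metis FS frame_op_selfadjoint)
  qed (use Q S_def in auto)
qed

end

text \<open>Since zero vectors contribute nothing, a frame over \<open>J\<close> becomes one over all of \<open>\<nat>\<close>.\<close>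

lemma (in cstar_module) standard_frame_cstar_frame:
  assumes "standard_frame ip J xs"
  obtains C D where "cstar_frame act ip (\<lambda>j. if j \<in> J then xs j else 0) C D"
proof -
  define ys where "ys j = (if j \<in> J then xs j else 0)" for j
  have terms: "frame_terms ip J xs x = (\<lambda>j. ip x (ys j) * ip (ys j) x)" for x
    by (auto simp: frame_terms_def ys_def)
  obtain C D where CD: "C > 0" "D > 0"
    and f: "\<And>x. \<exists>s. (\<lambda>j. ip x (ys j) * ip (ys j) x) sums s \<and>
      cstar_le (C *\<^sub>R ip x x) s \<and> cstar_le s (D *\<^sub>R ip x x)"
    using assms unfolding standard_frame_def terms by blast
  \<comment> \<open>On the zero module the given bounds need not be ordered, hence the
    maximum.\<close>
  have "cstar_frame act ip ys C (max C D)"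
  proof unfold_locales
    fix x
    obtain s where s: "(\<lambda>j. ip x (ys j) * ip (ys j) x) sums s"
      "cstar_le (C *\<^sub>R ip x x) s" "cstar_le s (D *\<^sub>R ip x x)" using f by blast
    have eq: "(\<Sum>j. ip x (ys j) * ip (ys j) x) = s" using s(1) by (simp add: sums_iff)
    show "(\<lambda>j. ip x (ys j) * ip (ys j) x) sums (\<Sum>j. ip x (ys j) * ip (ys j) x)"
      using s(1) eq by simp
    show "cstar_le (C *\<^sub>R ip x x) (\<Sum>j. ip x (ys j) * ip (ys j) x)" using s(2) eq by simp
    have "cstar_le (D *\<^sub>R ip x x) (max C D *\<^sub>R ip x x)"
      by (rule cstar_le_scaleR_right[OF ip_pos]) simp
    then show "cstar_le (\<Sum>j. ip x (ys j) * ip (ys j) x) (max C D *\<^sub>R ip x x)"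
      using s(3) eq cstar_le_trans by blast
  qed (use CD in auto)
  then show ?thesis using that unfolding ys_def by blast
qed

context cstar_frame
begin

text \<open>For a tight image frame, \<open>\<langle>G F G\<^sup>* z, z\<rangle> = \<langle>z, z\<rangle>\<close>, whence \<open>G F G\<^sup>* = 1\<close> by polarization.\<close>

lemma tight_image_inverse:
  fixes actK :: "'a \<Rightarrow> 'k::ab_group_add \<Rightarrow> 'k" and ipK :: "'k \<Rightarrow> 'k \<Rightarrow> 'a"
  assumes K: "hilbert_module actK ipK" and G: "is_adjoint ip ipK G Gs" and inj: "inj G"
    and tight: "\<And>z. (\<lambda>j. ipK z (G (ys j)) * ipK (G (ys j)) z) sums ipK z z"
  shows "frame_op (Gs (G x)) = x"
proof -
  interpret K: cstar_module actK ipK by unfold_locales (rule K)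
  have G1: "ipK (G u) z = ip u (Gs z)" for u z using G unfolding is_adjoint_def by blast
  have G2: "ipK z (G u) = ip (Gs z) u" for u z by (metis G1 K.cstar_ip cstar_ip)
  have "is_adjoint ipK ipK (\<lambda>z. G (frame_op (Gs z))) (\<lambda>z. G (frame_op (Gs z)))"
    by (simp add: is_adjoint_def G1 G2 frame_op_selfadjoint)
  moreover have "ipK (G (frame_op (Gs z))) z = ipK z z" for z
  proof -
    have "(\<lambda>j. ip (Gs z) (ys j) * ip (ys j) (Gs z)) sums ipK z z"
      using tight[of z] by (simp add: G1 G2)
    then show ?thesis
      using ip_frame_op[of "Gs z" "Gs z"] sums_unique2 by (fastforce simp: G1 frame_op_selfadjoint)
  qed
  ultimately have "G (frame_op (Gs (G x))) = G x" by (rule K.selfadjoint_eq_id)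
  then show ?thesis using inj by (simp add: inj_eq)
qed

end

text \<open>Testing \<open>T\<close> only against vectors in the range of the frame transform
  amounts to regarding the transform as an operator onto its range; the clause on \<open>T\<close>
  then expresses that \<open>S\<close> inverts the transform followed by its adjoint. Positivity
  takes the form of a factorization through \<open>R\<close> and its adjoint.\<close>

theorem theorem6p1:
  fixes act :: "'a::cstar_algebra \<Rightarrow> 'h::ab_group_add \<Rightarrow> 'h"
    and ip :: "'h \<Rightarrow> 'h \<Rightarrow> 'a"
    and J :: "nat set"
    and xs :: "nat \<Rightarrow> 'h"
  assumes H: "hilbert_module act ip"
    and gen: "countably_generated act ip"
    and frame: "standard_frame ip J xs"
  shows "\<exists>S. adjointable ip ip S
           \<and> (\<forall>x. hsums ip (\<lambda>j. act (ip x (S (xs j))) (xs j)) J x)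
           \<and> (\<forall>S'. adjointable ip ip S'
                  \<and> (\<forall>x. hsums ip (\<lambda>j. act (ip x (S' (xs j))) (xs j)) J x) \<longrightarrow> S' = S)
           \<and> (\<forall>(actK :: 'a \<Rightarrow> 'k::ab_group_add \<Rightarrow> 'k) ipK G Gs.
                 hilbert_module actK ipK \<and> adjointable ip ipK G \<and> alinear act actK G
                 \<and> bounded_op ip ipK G \<and> bij G
                 \<and> standard_nt_frame ipK J (G \<circ> xs)
                 \<and> is_adjoint ip ipK G Gs \<longrightarrow> S = Gs \<circ> G)
           \<and> (\<forall>x. frame_transform ip J xs x \<in> l2)
           \<and> (\<exists>T. \<forall>x. \<forall>b\<in>l2. l2ip (frame_transform ip J xs x) b = ip x (T b))
           \<and> (\<forall>T. (\<forall>x y. l2ip (frame_transform ip J xs x) (frame_transform ip J xs y)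
                         = ip x (T (frame_transform ip J xs y)))
                 \<longrightarrow> (\<forall>x. S (T (frame_transform ip J xs x)) = x
                         \<and> T (frame_transform ip J xs (S x)) = x))
           \<and> (\<exists>R Rs. is_adjoint ip ip R Rs \<and> S = Rs \<circ> R)
           \<and> (\<exists>S'. adjointable ip ip S' \<and> S \<circ> S' = id \<and> S' \<circ> S = id)
           \<and> standard_frame ip J (S \<circ> xs)"
proof -
  interpret cstar_module act ip by unfold_locales (rule H)
  define ys where "ys j = (if j \<in> J then xs j else 0)" for j
  obtain C D where "cstar_frame act ip (\<lambda>j. if j \<in> J then xs j else 0) C D"
    using standard_frame_cstar_frame[OF frame] .
  then interpret cstar_frame act ip ys C D unfolding ys_def .
  obtain S R where FS: "\<And>x. frame_op (S x) = x" and SF: "\<And>x. S (frame_op x) = x"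
    and Ssa: "\<And>x y. ip (S x) y = ip x (S y)" and R: "is_adjoint ip ip R R" "S = R \<circ> R"
    by (rule frame_op_inverse) (rule that)
  have ft: "frame_transform ip J xs x = (\<lambda>j. ip x (ys j))" for x
    by (auto simp: frame_transform_def ys_def)
  \<comment> \<open>The padding vectors are zero and every action on zero vanishes, whatever
    \<open>U\<close> is.\<close>
  have hs: "hsums ip (\<lambda>j. act (ip x (U (xs j))) (xs j)) J x
      \<longleftrightarrow> hlim (\<lambda>n. \<Sum>j<n. act (ip x (U (ys j))) (ys j)) x" for U x
  proof -
    have "(\<Sum>j\<in>J \<inter> {..<n}. act (ip x (U (xs j))) (xs j)) = (\<Sum>j<n. act (ip x (U (ys j))) (ys j))" for n
      by (rule sum.mono_neutral_cong_left) (auto simp: ys_def)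
    then show ?thesis by (simp add: hsums_def)
  qed
  have recon: "hsums ip (\<lambda>j. act (ip x (S (xs j))) (xs j)) J x" for x
    using hlim_frame_op[of "S x"] unfolding hs by (simp add: FS Ssa)
  have unique: "S' = S"
    if adj: "adjointable ip ip S'" and rec: "\<forall>x. hsums ip (\<lambda>j. act (ip x (S' (xs j))) (xs j)) J x" for S'
  proof -
    obtain Ts where Ts: "is_adjoint ip ip S' Ts" using adj unfolding adjointable_def by blast
    have Ts1: "ip (S' x) y = ip x (Ts y)" and Ts2: "ip y (S' x) = ip (Ts y) x" for x y
      using Ts adjoint_swap[OF Ts] unfolding is_adjoint_def by metis+
    \<comment> \<open>Reconstruction by \<open>S'\<close> is the series of
      \<open>frame_op (Ts x)\<close>, so \<open>Ts\<close> is a right inverse of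
      \<open>frame_op\<close> and equals \<open>S\<close>; its adjoint \<open>S'\<close> is then
      \<open>S\<close> as well.\<close>
    have "frame_op (Ts x) = x" for x
    proof (rule hlim_unique[OF hlim_frame_op])
      show "hlim (\<lambda>n. \<Sum>j<n. act (ip (Ts x) (ys j)) (ys j)) x"
        using rec unfolding hs by (simp add: Ts2)
    qed
    then have "Ts = S" by (metis SF ext)
    then show ?thesis by (intro ext ip_eqI) (simp add: Ts1 Ssa)
  qed
  have image: "S = Gs \<circ> G"
    if K: "hilbert_module actK ipK" and bij: "bij G" and nt: "standard_nt_frame ipK J (G \<circ> xs)"
      and G: "is_adjoint ip ipK G Gs"
    for actK :: "'a \<Rightarrow> 'k \<Rightarrow> 'k" and ipK G Gs
  proof
    fix x
    interpret K: cstar_module actK ipK by unfold_locales (rule K)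
    have G1: "ipK (G u) z = ip u (Gs z)" for u z using G unfolding is_adjoint_def by blast
    \<comment> \<open>The padding zeros must be sent to zero for the frame terms over
      \<open>J\<close> and over all indices to agree.\<close>
    have "G 0 = 0" by (rule K.ip_eqI) (simp add: G1)
    then have terms: "frame_terms ipK J (G \<circ> xs) z = (\<lambda>j. ipK z (G (ys j)) * ipK (G (ys j)) z)" for z
      by (auto simp: frame_terms_def ys_def)
    have "(\<lambda>j. ipK z (G (ys j)) * ipK (G (ys j)) z) sums ipK z z" for z
      using nt cstar_le_antisym unfolding standard_nt_frame_def terms by metis
    then have "frame_op (Gs (G x)) = x"
      using bij by (intro tight_image_inverse[OF K G]) (auto simp: bij_is_inj)
    then show "S x = (Gs \<circ> G) x" by (metis SF comp_apply)
  qed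
  have l2: "frame_transform ip J xs x \<in> l2" for x
    by (simp add: ft l2_def analysis_summable)
  have adj: "l2ip (frame_transform ip J xs x) b = ip x (synthesis b)" if "b \<in> l2" for x b
    using ip_synthesis[of b x] that by (simp add: l2ip_def ft l2_def sums_iff)
  \<comment> \<open>The adjoint relation on the range already determines \<open>T\<close>
    there.\<close>
  have inv: "T (frame_transform ip J xs y) = frame_op y"
    if "\<forall>x y. l2ip (frame_transform ip J xs x) (frame_transform ip J xs y)
      = ip x (T (frame_transform ip J xs y))" for T y
  proof (rule ip_eqI_right)
    show "ip x (T (frame_transform ip J xs y)) = ip x (frame_op y)" for x
      using that adj[OF l2, of x y] by (simp add: frame_op_def ft)
  qed
  have Sadj: "adjointable ip ip S" and Fadj: "adjointable ip ip frame_op"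
    unfolding adjointable_def is_adjoint_def using Ssa frame_op_selfadjoint by blast+
  \<comment> \<open>As \<open>frame_op (S x) = x\<close>, the dual frame sum at \<open>x\<close> is
    \<open>ip x (S x)\<close>, and the bounds on the squared frame operator at \<open>S x\<close>
    become the reciprocal bounds \<open>1 / D\<close> and \<open>1 / C\<close>.\<close>
  have dual: "standard_frame ip J (S \<circ> xs)"
    unfolding standard_frame_def
  proof (intro exI conjI allI)
    show "1 / D > 0" "1 / C > 0" using C D by simp_all
    fix x
    have "frame_terms ip J (S \<circ> xs) x = (\<lambda>j. ip (S x) (ys j) * ip (ys j) (S x))"
      by (auto simp: frame_terms_def ys_def Ssa)
    then show "frame_terms ip J (S \<circ> xs) x sums ip x (S x)"
      using ip_frame_op[of "S x" "S x"] by (simp add: FS flip: Ssa)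
    have "cstar_le ((1 / D) *\<^sub>R ip x x) ((1 / D) *\<^sub>R D *\<^sub>R ip x (S x))"
      using frame_op_square_upper[of "S x"] D by (intro cstar_le_scaleR_mono) (simp_all add: FS)
    then show "cstar_le ((1 / D) *\<^sub>R ip x x) (ip x (S x))" using D by simp
    have "cstar_le ((1 / C) *\<^sub>R C *\<^sub>R ip x (S x)) ((1 / C) *\<^sub>R ip x x)"
      using frame_op_square_lower[of "S x"] C by (intro cstar_le_scaleR_mono) (simp_all add: FS)
    then show "cstar_le (ip x (S x)) ((1 / C) *\<^sub>R ip x x)" using C by simp
  qed
  show ?thesis
  proof (rule exI[of _ S], intro conjI allI impI)
    show "adjointable ip ip S" by (rule Sadj)
    show "hsums ip (\<lambda>j. act (ip x (S (xs j))) (xs j)) J x" for x by (rule recon)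
    show "S' = S" if "adjointable ip ip S'
        \<and> (\<forall>x. hsums ip (\<lambda>j. act (ip x (S' (xs j))) (xs j)) J x)" for S'
      using that unique by blast
    show "S = Gs \<circ> G"
      if "hilbert_module actK ipK \<and> adjointable ip ipK G \<and> alinear act actK G
        \<and> bounded_op ip ipK G \<and> bij G \<and> standard_nt_frame ipK J (G \<circ> xs) \<and> is_adjoint ip ipK G Gs"
      for actK :: "'a \<Rightarrow> 'k \<Rightarrow> 'k" and ipK G Gs
      using that image by blast
    show "frame_transform ip J xs x \<in> l2" for x by (rule l2)
    show "\<exists>T. \<forall>x. \<forall>b\<in>l2. l2ip (frame_transform ip J xs x) b = ip x (T b)"
      using adj by blast
    show "S (T (frame_transform ip J xs x)) = x" "T (frame_transform ip J xs (S x)) = x"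
      if "\<forall>x y. l2ip (frame_transform ip J xs x) (frame_transform ip J xs y)
        = ip x (T (frame_transform ip J xs y))" for T x
      using inv[OF that] by (simp_all add: SF FS)
    show "\<exists>R Rs. is_adjoint ip ip R Rs \<and> S = Rs \<circ> R" using R by blast
    show "\<exists>S'. adjointable ip ip S' \<and> S \<circ> S' = id \<and> S' \<circ> S = id"
      using Fadj by (intro exI[of _ frame_op]) (auto simp: FS SF)
    show "standard_frame ip J (S \<circ> xs)" by (rule dual)
  qed
qed

end
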